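(* Let $\boldsymbol k$ be an indeterminate. For every partition $\lambda$, the Jack symmetric function $P^{(\boldsymbol k)}_\lambda$ satisfies $$\langle P^{(\boldsymbol k)}_\lambda,P^{(\boldsymbol k)}_\lambda\rangle=\prod_{s\in\lambda}\frac{l(s)+(a(s)+1)\boldsymbol k}{l(s)+1+a(s)\boldsymbol k},$$ where the product runs over the boxes $s$ of the Young diagram of $\lambda$, and $a(s)$, $l(s)$ are the arm and leg lengths of $s$.
   Context: $\Lambda_{\mathbb Q(\boldsymbol k)}$ is the ring of symmetric functions over $\mathbb Q(\boldsymbol k)$ with power sums $p_\lambda=p_{\lambda_1}p_{\lambda_2}\cdots$ and monomial symmetric functions $m_\lambda$. The inner product is $\langle p_\lambda,p_\mu\rangle=\delta_{\lambda\mu}\boldsymbol k^{l(\lambda)}z_\lambda$, where $l(\lambda)$ is the length of $\lambda$ and $z_\lambda=\prod_j j^{m_j}m_j!$ for $\lambda=(1^{m_1}2^{m_2}\cdots)$. Let $\ge$ be the dominance order on partitions. $P^{(\boldsymbol k)}_\lambda$ is characterized by $P^{(\boldsymbol k)}_\lambda=m_\lambda+\sum_{\mu<\lambda}u^{(\boldsymbol k)}_{\lambda\mu}m_\mu$ with $u^{(\boldsymbol k)}_{\lambda\mu}\in\mathbb Q(\boldsymbol k)$, and $\langle P^{(\boldsymbol k)}_\lambda,P^{(\boldsymbol k)}_\mu\rangle=0$ for $\lambda\ne\mu$. The boxes of $\lambda$ are the pairs $s=(i,j)$ with $i\ge1$, $1\le j\le\lambda_i$; $a(s)=\lambda_i-j$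 and $l(s)=\lambda'_j-i$, where $\lambda'$ is the conjugate partition. *)

theory Defs
  imports
    "HOL-Computational_Algebra.Fraction_Field"
    "HOL-Computational_Algebra.Polynomial"
    "HOL-Library.Multiset"
begin

section \<open>The ring of symmetric functions\<close>

text \<open>
  A monomial in the variables \<open>x\<^sub>0, x\<^sub>1, \<dots>\<close> is encoded by the multiset of the indices of
  its factors: \<^term>\<open>count \<alpha> i\<close> is the exponent of \<open>x\<^sub>i\<close>, \<^term>\<open>size \<alpha>\<close> is the degree, and the
  product of monomials is the sum of multisets. A formal power series is the function that
  maps each monomial to its coefficient. A symmetric function is a power series of bounded
  degree that is invariant under all permutations of the variables.
\<close>

lemma finite_subset_mset: "finite {\<beta>. \<beta> \<subseteq># (\<alpha> :: 'b multiset)}"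
proof (induction \<alpha>)
  case empty
  then show ?case by simp
next
  case (add x \<alpha>)
  have "{\<beta>. \<beta> \<subseteq># add_mset x \<alpha>} \<subseteq> {\<beta>. \<beta> \<subseteq># \<alpha>} \<union> add_mset x ` {\<beta>. \<beta> \<subseteq># \<alpha>}"
  proof
    fix \<beta> assume "\<beta> \<in> {\<beta>. \<beta> \<subseteq># add_mset x \<alpha>}"
    then have \<beta>: "\<beta> \<subseteq># add_mset x \<alpha>" by simp
    show "\<beta> \<in> {\<beta>. \<beta> \<subseteq># \<alpha>} \<union> add_mset x ` {\<beta>. \<beta> \<subseteq># \<alpha>}"
    proof (cases "x \<in># \<beta>")
      case True
      then obtain \<gamma> where "\<beta> = add_mset x \<gamma>" by (meson multi_member_split)
      with \<beta> show ?thesis by auto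
    next
      case False
      have "count \<beta> y \<le> count \<alpha> y" for y
        using mset_subset_eq_count[OF \<beta>, of y] False
        by (cases "y = x") (auto simp: not_in_iff)
      then show ?thesis by (auto intro: mset_subset_eqI)
    qed
  qed
  then show ?case using add.IH by (meson finite_UnI finite_imageI finite_subset)
qed

definition is_symfun :: "(nat multiset \<Rightarrow> 'a::zero) \<Rightarrow> bool" where
  "is_symfun f \<longleftrightarrow>
     (\<forall>\<pi> \<alpha>. bij \<pi> \<longrightarrow> f (image_mset \<pi> \<alpha>) = f \<alpha>) \<and>
     (\<exists>d. \<forall>\<alpha>. f \<alpha> \<noteq> 0 \<longrightarrow> size \<alpha> \<le> d)"

definition series_mult ::
    "(nat multiset \<Rightarrow> 'a::comm_ring_1) \<Rightarrow> (nat multiset \<Rightarrow> 'a) \<Rightarrow> nat multiset \<Rightarrow> 'a" where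
  "series_mult f g \<alpha> = (\<Sum>\<beta> | \<beta> \<subseteq># \<alpha>. f \<beta> * g (\<alpha> - \<beta>))"

lemma series_mult_commute: "series_mult f g = series_mult g f"
proof
  fix \<alpha>
  show "series_mult f g \<alpha> = series_mult g f \<alpha>"
    unfolding series_mult_def
    by (rule sum.reindex_bij_witness[where i = "\<lambda>\<beta>. \<alpha> - \<beta>" and j = "\<lambda>\<beta>. \<alpha> - \<beta>"])
       (auto simp: mult.commute double_diff subset_mset.add_diff_inverse
         subset_mset.diff_diff_right)
qed

lemma series_mult_assoc: "series_mult (series_mult f g) h = series_mult f (series_mult g h)"
proof
  fix \<alpha>
  have "series_mult (series_mult f g) h \<alpha> =
      (\<Sum>(\<beta>, \<gamma>) \<in> Sigma {\<beta>. \<beta> \<subseteq># \<alpha>} (\<lambda>\<beta>. {\<gamma>. \<gamma> \<subseteq># \<beta>}). f \<gamma> * g (\<beta> - \<gamma>) * h (\<alpha> - \<beta>))"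
    unfolding series_mult_def sum_distrib_right
    by (rule sum.Sigma) (auto simp: finite_subset_mset)
  also have "\<dots> = (\<Sum>(\<gamma>, \<delta>) \<in> Sigma {\<gamma>. \<gamma> \<subseteq># \<alpha>} (\<lambda>\<gamma>. {\<delta>. \<delta> \<subseteq># \<alpha> - \<gamma>}).
      f \<gamma> * (g \<delta> * h (\<alpha> - \<gamma> - \<delta>)))"
  proof (rule sum.reindex_bij_witness[where
        i = "\<lambda>(\<gamma>, \<delta>). (\<gamma> + \<delta>, \<gamma>)" and j = "\<lambda>(\<beta>, \<gamma>). (\<gamma>, \<beta> - \<gamma>)"], goal_cases)
    case (4 b)
    then show ?case
      by (auto simp: subset_mset.le_diff_conv2 subset_mset.diff_add_assoc add.commute)
  qed (auto simp: subset_mset.le_diff_conv2 add.commute mult.assoc subset_mset.diff_add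
      intro: subset_mset.order_trans)
  also have "\<dots> = series_mult f (series_mult g h) \<alpha>"
    unfolding series_mult_def sum_distrib_left
    by (rule sum.Sigma[symmetric]) (auto simp: finite_subset_mset)
  finally show "series_mult (series_mult f g) h \<alpha> = series_mult f (series_mult g h) \<alpha>" .
qed

lemma is_symfun_pointwise:
  assumes "is_symfun f" and "is_symfun g" and "h 0 0 = 0"
  shows "is_symfun (\<lambda>\<alpha>. h (f \<alpha>) (g \<alpha>))"
proof -
  obtain d e where d: "\<forall>\<alpha>. f \<alpha> \<noteq> 0 \<longrightarrow> size \<alpha> \<le> d" and e: "\<forall>\<alpha>. g \<alpha> \<noteq> 0 \<longrightarrow> size \<alpha> \<le> e"
    using assms(1,2) unfolding is_symfun_def by blast
  have "size \<alpha> \<le> max d e" if "h (f \<alpha>) (g \<alpha>) \<noteq> 0" for \<alpha>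
  proof -
    have "f \<alpha> \<noteq> 0 \<or> g \<alpha> \<noteq> 0" using that assms(3) by metis
    then show ?thesis using d e by (auto simp: le_max_iff_disj)
  qed
  then show ?thesis using assms(1,2) unfolding is_symfun_def by auto
qed

lemma is_symfun_mult:
  assumes "is_symfun f" and "is_symfun g"
  shows "is_symfun (series_mult f g)"
proof -
  have sym: "series_mult f g (image_mset \<pi> \<alpha>) = series_mult f g \<alpha>"
    if \<pi>: "bij \<pi>" for \<pi> :: "nat \<Rightarrow> nat" and \<alpha>
  proof -
    have inv: "image_mset \<pi> (image_mset (inv \<pi>) \<beta>) = \<beta>"
              "image_mset (inv \<pi>) (image_mset \<pi> \<beta>) = \<beta>" for \<beta>
      using \<pi> by (simp_all add: multiset.map_comp o_def bij_is_surj surj_f_inv_f bij_is_inj inv_f_f)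
    have "series_mult f g \<alpha> = series_mult f g (image_mset \<pi> \<alpha>)"
      unfolding series_mult_def
    proof (rule sum.reindex_bij_witness[where
          i = "image_mset (inv \<pi>)" and j = "image_mset \<pi>"], goal_cases)
      case (4 \<beta>)
      then show ?case using image_mset_subseteq_mono[of \<beta> "image_mset \<pi> \<alpha>" "inv \<pi>"] inv by simp
    next
      case (5 \<beta>)
      then have "image_mset \<pi> \<alpha> - image_mset \<pi> \<beta> = image_mset \<pi> (\<alpha> - \<beta>)"
        by (simp add: image_mset_Diff)
      then show ?case using assms \<pi> by (simp add: is_symfun_def)
    qed (auto simp: inv intro: image_mset_subseteq_mono)
    then show ?thesis by simp
  qed
  obtain d e where d: "\<And>\<alpha>. f \<alpha> \<noteq> 0 \<Longrightarrow> size \<alpha> \<le> d" and e: "\<And>\<alpha>. g \<alpha> \<noteq> 0 \<Longrightarrow> size \<alpha> \<le> e"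
    using assms unfolding is_symfun_def by blast
  have "size \<alpha> \<le> d + e" if "series_mult f g \<alpha> \<noteq> 0" for \<alpha>
  proof -
    have "\<exists>\<beta>. \<beta> \<subseteq># \<alpha> \<and> f \<beta> * g (\<alpha> - \<beta>) \<noteq> 0"
    proof (rule ccontr)
      assume "\<not> ?thesis"
      then have "series_mult f g \<alpha> = 0" unfolding series_mult_def by (intro sum.neutral) auto
      with that show False by simp
    qed
    then obtain \<beta> where \<beta>: "\<beta> \<subseteq># \<alpha>" "f \<beta> * g (\<alpha> - \<beta>) \<noteq> 0" by blast
    then have "f \<beta> \<noteq> 0" and "g (\<alpha> - \<beta>) \<noteq> 0" by auto
    with d e have "size \<beta> \<le> d" "size (\<alpha> - \<beta>) \<le> e" by blast+
    then show ?thesis using \<beta>(1) by (simp add: size_Diff_submset)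
  qed
  with sym show ?thesis unfolding is_symfun_def by blast
qed

typedef (overloaded) 'a symfun = "{f :: nat multiset \<Rightarrow> 'a::comm_ring_1. is_symfun f}"
  morphisms sf_coeff Abs_symfun
  by (rule exI[of _ "\<lambda>_. 0"]) (simp add: is_symfun_def)

setup_lifting type_definition_symfun

instantiation symfun :: (comm_ring_1) comm_ring_1
begin

lift_definition zero_symfun :: "'a symfun" is "\<lambda>_. 0"
  by (simp add: is_symfun_def)

lift_definition one_symfun :: "'a symfun" is "\<lambda>\<alpha>. if \<alpha> = {#} then 1 else 0"
  by (auto simp: is_symfun_def)

lift_definition uminus_symfun :: "'a symfun \<Rightarrow> 'a symfun" is "\<lambda>f \<alpha>. - f \<alpha>"
  by (simp add: is_symfun_def)

lift_definition plus_symfun :: "'a symfun \<Rightarrow> 'a symfun \<Rightarrow> 'a symfun" is "\<lambda>f g \<alpha>. f \<alpha> + g \<alpha>"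
  by (rule is_symfun_pointwise) simp_all

lift_definition minus_symfun :: "'a symfun \<Rightarrow> 'a symfun \<Rightarrow> 'a symfun" is "\<lambda>f g \<alpha>. f \<alpha> - g \<alpha>"
  by (rule is_symfun_pointwise) simp_all

lift_definition times_symfun :: "'a symfun \<Rightarrow> 'a symfun \<Rightarrow> 'a symfun" is series_mult
  by (rule is_symfun_mult)

instance
proof
  fix f g h :: "'a symfun"
  show "f * g * h = f * (g * h)" by transfer (rule series_mult_assoc)
  show "f * g = g * f" by transfer (rule series_mult_commute)
  show "1 * f = f"
  proof (transfer, rule ext)
    fix f :: "nat multiset \<Rightarrow> 'a" and \<alpha>
    have "series_mult (\<lambda>\<alpha>. if \<alpha> = {#} then 1 else 0) f \<alpha> =
        (\<Sum>\<beta> | \<beta> \<subseteq># \<alpha>. if \<beta> = {#} then f \<alpha> else 0)"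
      unfolding series_mult_def by (rule sum.cong) auto
    then show "series_mult (\<lambda>\<alpha>. if \<alpha> = {#} then 1 else 0) f \<alpha> = f \<alpha>"
      by (simp add: finite_subset_mset)
  qed
  show "(f + g) * h = f * h + g * h"
    by transfer (simp add: series_mult_def fun_eq_iff distrib_right sum.distrib)
  show "(0 :: 'a symfun) \<noteq> 1"
    by transfer (metis zero_neq_one)
qed (transfer; simp add: fun_eq_iff algebra_simps)+

end

lift_definition sf_scale :: "'a::comm_ring_1 \<Rightarrow> 'a symfun \<Rightarrow> 'a symfun" is "\<lambda>c f \<alpha>. c * f \<alpha>"
  by (rule is_symfun_pointwise[where h = "\<lambda>x _. _ * x"]) simp_all

global_interpretation symfun: vector_space "sf_scale :: 'a::field \<Rightarrow> 'a symfun \<Rightarrow> 'a symfun"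
  by unfold_locales (transfer; simp add: fun_eq_iff algebra_simps)+


section \<open>Partitions\<close>

text \<open>A partition is the weakly decreasing list of its nonzero parts, so \<^term>\<open>length\<close> is its
  length and \<^term>\<open>sum_list\<close> its weight. Partitions are called \<open>\<nu>, \<mu>\<close>, as \<open>\<lambda>\<close> is reserved syntax.\<close>

definition is_partition :: "nat list \<Rightarrow> bool" where
  "is_partition \<nu> \<longleftrightarrow> sorted_wrt (\<ge>) \<nu> \<and> 0 \<notin> set \<nu>"

text \<open>Parts are numbered from \<open>1\<close>, and a partition is continued by zeros.\<close>

definition part :: "nat list \<Rightarrow> nat \<Rightarrow> nat" where
  "part \<nu> i = (if 1 \<le> i \<and> i \<le> length \<nu> then \<nu> ! (i - 1) else 0)"

definition conj_part :: "nat list \<Rightarrow> nat \<Rightarrow> nat" where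
  "conj_part \<nu> j = card {i. 1 \<le> i \<and> i \<le> length \<nu> \<and> j \<le> part \<nu> i}"

definition boxes :: "nat list \<Rightarrow> (nat \<times> nat) set" where
  "boxes \<nu> = {(i, j). 1 \<le> i \<and> 1 \<le> j \<and> j \<le> part \<nu> i}"

text \<open>For boxes of \<open>\<nu>\<close> the natural-number subtractions below do not truncate.\<close>

definition arm :: "nat list \<Rightarrow> nat \<times> nat \<Rightarrow> nat" where
  "arm \<nu> s = part \<nu> (fst s) - snd s"

definition leg :: "nat list \<Rightarrow> nat \<times> nat \<Rightarrow> nat" where
  "leg \<nu> s = conj_part \<nu> (snd s) - fst s"

definition dominated :: "nat list \<Rightarrow> nat list \<Rightarrow> bool" where
  "dominated \<mu> \<nu> \<longleftrightarrow>
     sum_list \<mu> = sum_list \<nu> \<and> (\<forall>r. (\<Sum>i=1..r. part \<mu> i) \<le> (\<Sum>i=1..r. part \<nu> i))"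

definition z_part :: "nat list \<Rightarrow> nat" where
  "z_part \<nu> = (\<Prod>j\<in>set \<nu>. j ^ count_list \<nu> j * fact (count_list \<nu> j))"

lemma finite_boxes: "finite (boxes \<nu>)"
proof -
  have "boxes \<nu> \<subseteq> (SIGMA i:{1..length \<nu>}. {1..part \<nu> i})"
    by (auto simp: boxes_def part_def split: if_splits)
  then show ?thesis by (rule finite_subset) simp
qed

lemma finite_partitions: "finite {\<mu>. is_partition \<mu> \<and> sum_list \<mu> = n}"
proof -
  have "{\<mu>. is_partition \<mu> \<and> sum_list \<mu> = n} \<subseteq> {\<mu>. set \<mu> \<subseteq> {0..n} \<and> length \<mu> \<le> n}"
  proof safe
    fix \<mu> x assume "is_partition \<mu>" and "x \<in> set \<mu>" and "n = sum_list \<mu>"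
    then show "x \<in> {0..sum_list \<mu>}" by (simp add: member_le_sum_list)
  next
    fix \<mu> assume "is_partition \<mu>"
    then have "0 \<notin> set \<mu>" by (simp add: is_partition_def)
    then show "length \<mu> \<le> sum_list \<mu>" by (induction \<mu>) auto
  qed
  then show ?thesis by (rule finite_subset) (simp add: finite_lists_length_le)
qed


section \<open>Monomial symmetric functions and power sums\<close>

definition exponents :: "nat multiset \<Rightarrow> nat multiset" where
  "exponents \<alpha> = image_mset (count \<alpha>) (mset_set (set_mset \<alpha>))"

lemma exponents_bij:
  assumes "bij \<pi>"
  shows "exponents (image_mset \<pi> \<alpha>) = exponents \<alpha>"
proof -
  have inj: "inj \<pi>" using assms by (rule bij_is_inj)
  then have count: "count (image_mset \<pi> \<alpha>) (\<pi> i) = count \<alpha> i" for i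
    by (induction \<alpha>) (auto simp: inj_eq)
  from inj have "mset_set (\<pi> ` set_mset \<alpha>) = image_mset \<pi> (mset_set (set_mset \<alpha>))"
    by (metis image_mset_mset_set inj_on_subset subset_UNIV)
  then show ?thesis
    using inj by (simp add: exponents_def multiset.map_comp o_def count)
qed

lemma sum_mset_exponents: "sum_mset (exponents \<alpha>) = size \<alpha>"
  by (simp add: exponents_def size_multiset_overloaded_eq sum_unfold_sum_mset)

text \<open>\<open>m\<^sub>\<nu>\<close> is the sum of the monomials whose nonzero exponents are, in some order, the parts
  of \<open>\<nu>\<close>.\<close>

lift_definition monomial_sf :: "nat list \<Rightarrow> 'a::comm_ring_1 symfun" is
  "\<lambda>\<nu> \<alpha>. if exponents \<alpha> = mset \<nu> then 1 else 0"
  unfolding is_symfun_def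
  by (auto simp: exponents_bij sum_mset_exponents[symmetric] sum_mset_sum_list)

text \<open>\<open>p\<^sub>r = \<Sum>\<^sub>i x\<^sub>i\<^sup>r\<close>; only used for \<open>r \<ge> 1\<close>.\<close>

lift_definition power_sum :: "nat \<Rightarrow> 'a::comm_ring_1 symfun" is
  "\<lambda>r \<alpha>. if \<exists>i. \<alpha> = replicate_mset r i then 1 else 0"
proof -
  fix r
  have "(\<exists>i. image_mset \<pi> \<alpha> = replicate_mset r i) \<longleftrightarrow> (\<exists>i. \<alpha> = replicate_mset r i)"
    if "bij \<pi>" for \<pi> :: "nat \<Rightarrow> nat" and \<alpha>
  proof
    assume "\<exists>i. image_mset \<pi> \<alpha> = replicate_mset r i"
    then obtain i where "image_mset \<pi> \<alpha> = replicate_mset r i" ..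
    then have "image_mset (inv \<pi>) (image_mset \<pi> \<alpha>) = replicate_mset r (inv \<pi> i)" by simp
    then show "\<exists>i. \<alpha> = replicate_mset r i"
      using that by (auto simp: multiset.map_comp o_def bij_is_inj)
  qed auto
  then show "is_symfun (\<lambda>\<alpha>. if \<exists>i. \<alpha> = replicate_mset r i then 1 else 0 :: 'a)"
    by (auto simp: is_symfun_def)
qed

definition power_sum_part :: "nat list \<Rightarrow> 'a::comm_ring_1 symfun" where
  "power_sum_part \<nu> = prod_list (map power_sum \<nu>)"


section \<open>Jack symmetric functions\<close>

type_synonym ratfun = "rat poly fract"

definition kk :: ratfun where
  "kk = Fraction_Field.Fract [:0, 1:] 1"

text \<open>The coefficient of \<open>p\<^sub>\<nu>\<close> in the expansion of \<open>f\<close> in the basis of the power sums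
  \<open>p\<^sub>\<mu>\<close> (which are a basis, and pairwise distinct, because the field has characteristic \<open>0\<close>).\<close>

definition power_sum_coord :: "ratfun symfun \<Rightarrow> nat list \<Rightarrow> ratfun" where
  "power_sum_coord f \<nu> =
     symfun.representation (power_sum_part ` {\<mu>. is_partition \<mu>}) f (power_sum_part \<nu>)"

text \<open>The bilinear form with \<open>\<langle>p\<^sub>\<nu>, p\<^sub>\<mu>\<rangle> = \<delta>\<^sub>\<nu>\<^sub>\<mu> k\<^bsup>l(\<nu>)\<^esup> z\<^sub>\<nu>\<close>.\<close>

definition jack_inner :: "ratfun symfun \<Rightarrow> ratfun symfun \<Rightarrow> ratfun" where
  "jack_inner f g =
     (\<Sum>\<nu> | is_partition \<nu> \<and> power_sum_coord f \<nu> \<noteq> 0.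
        power_sum_coord f \<nu> * power_sum_coord g \<nu> * (kk ^ length \<nu> * of_nat (z_part \<nu>)))"

text \<open>The defining properties of the family \<open>\<nu> \<mapsto> P\<^sub>\<nu>\<close> of Jack symmetric functions.\<close>

definition is_jack :: "(nat list \<Rightarrow> ratfun symfun) \<Rightarrow> bool" where
  "is_jack P \<longleftrightarrow>
     (\<forall>\<nu>. is_partition \<nu> \<longrightarrow>
        (\<exists>u. P \<nu> = monomial_sf \<nu> +
           (\<Sum>\<mu> | is_partition \<mu> \<and> dominated \<mu> \<nu> \<and> \<mu> \<noteq> \<nu>. sf_scale (u \<mu>) (monomial_sf \<mu>)))) \<and>
     (\<forall>\<nu> \<mu>. is_partition \<nu> \<longrightarrow> is_partition \<mu> \<longrightarrow> \<nu> \<noteq> \<mu> \<longrightarrow> jack_inner (P \<nu>) (P \<mu>) = 0)"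

end

theory Submission
  imports Defs "HOL-Computational_Algebra.Formal_Power_Series" "Jordan_Normal_Form.Determinant"
begin

text \<open>
  The norm is computed by removing the first column of the diagram. Let \<open>g\<^sub>s\<close> be defined by
  \<open>k s g\<^sub>s = \<Sum>\<^sub>r p\<^sub>r g\<^bsub>s-r\<^esub>\<close>; the products \<open>g\<^sub>\<nu>\<close> are dual to the \<open>m\<^sub>\<nu>\<close>. For a partition with at most \<open>n\<close>
  parts, listed increasingly as \<open>\<nu>\<^sub>0 \<le> \<dots> \<le> \<nu>\<^bsub>n-1\<^esub>\<close>, consider the determinants
  \<open>A\<^sub>\<nu> = det ((j + k (s\<^sub>i - j)) g\<^bsub>s\<^sub>i - j\<^esub>)\<close> and \<open>B\<^sub>\<nu> = det ((j + 1 + k (s\<^sub>i - j)) g\<^bsub>s\<^sub>i - j\<^esub>)\<close> with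
  \<open>s\<^sub>i = \<nu>\<^sub>i + i\<close>. Both are combinations of the \<open>P\<^sub>\<mu>\<close> with \<open>\<mu> \<ge> \<nu>\<close>, and the coefficient of \<open>P\<^sub>\<nu>\<close> is the product
  of the diagonal factors divided by the norm of \<open>P\<^sub>\<nu>\<close>. The generating function of the \<open>g\<^sub>s\<close> and Newton's identities give
  \<open>\<Sum>\<^sub>m (-1)\<^sup>m e\<^sub>m (m + k (s - m)) g\<^bsub>s-m\<^esub> = 0\<close>, a linear relation between \<open>n + 1\<close> consecutive
  columns in \<open>n\<close> variables, so \<open>A\<^bsub>\<nu> + (1,\<dots>,1)\<^esub> = e\<^sub>n B\<^sub>\<nu>\<close> there. Since multiplication by \<open>e\<^sub>n\<close>
  is lower triangular on the \<open>P\<close> and this identity makes it upper triangular, it maps \<open>P\<^sub>\<nu>\<close> to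
  \<open>P\<^bsub>\<nu> + (1,\<dots>,1)\<^esub>\<close>, and comparing the diagonal coefficients gives the quotient of the two norms,
  which is the product over the boxes of the first column.
\<close>

section \<open>Coefficients of symmetric functions\<close>

lemma sf_coeff_simps [simp]:
  "sf_coeff 0 \<alpha> = 0"
  "sf_coeff (f + g) \<alpha> = sf_coeff f \<alpha> + sf_coeff g \<alpha>"
  "sf_coeff (f - g) \<alpha> = sf_coeff f \<alpha> - sf_coeff g \<alpha>"
  "sf_coeff (- f) \<alpha> = - sf_coeff f \<alpha>"
  "sf_coeff (sf_scale c f) \<alpha> = c * sf_coeff f \<alpha>"
  "sf_coeff 1 \<alpha> = (if \<alpha> = {#} then 1 else 0)"
  by (simp_all add: zero_symfun.rep_eq plus_symfun.rep_eq minus_symfun.rep_eq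
      uminus_symfun.rep_eq sf_scale.rep_eq one_symfun.rep_eq)

lemma sf_coeff_sum [simp]: "sf_coeff (sum f A) \<alpha> = (\<Sum>x\<in>A. sf_coeff (f x) \<alpha>)"
  by (induction A rule: infinite_finite_induct) simp_all

lemma sf_coeff_mult: "sf_coeff (f * g) \<alpha> = (\<Sum>\<beta> | \<beta> \<subseteq># \<alpha>. sf_coeff f \<beta> * sf_coeff g (\<alpha> - \<beta>))"
  by (simp add: times_symfun.rep_eq series_mult_def)

lemma sf_coeff_monomial_sf:
  "sf_coeff (monomial_sf \<nu>) \<alpha> = (if exponents \<alpha> = mset \<nu> then 1 else 0)"
  by (simp add: monomial_sf.rep_eq)

lemma sf_coeff_power_sum:
  "sf_coeff (power_sum r) \<alpha> = (if \<exists>i. \<alpha> = replicate_mset r i then 1 else 0)"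
  by (simp add: power_sum.rep_eq)

lemma sf_eqI: "(\<And>\<alpha>. sf_coeff f \<alpha> = sf_coeff g \<alpha>) \<Longrightarrow> f = g"
  by (simp add: sf_coeff_inject[symmetric] fun_eq_iff)

lemma sf_scale_mult_left: "sf_scale c (f * g) = sf_scale c f * g"
  by (rule sf_eqI) (simp add: sf_coeff_mult sum_distrib_left mult.assoc)

lemma sf_scale_mult_right: "sf_scale c (f * g) = f * sf_scale c g"
  by (metis mult.commute sf_scale_mult_left)

lemmas sf_scale_mult = sf_scale_mult_left[symmetric] sf_scale_mult_right[symmetric]

text \<open>Signs of permutations and integer multiples arise as ring elements; as scalars they can
  be pulled out of coefficients and of the bilinear form.\<close>

lemma sf_scale_of_int: "sf_scale (of_int c) f = of_int c * f"
proof -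
  have *: "sf_scale (of_nat m) f = of_nat m * f" for m
  proof (induction m)
    case (Suc m)
    have "sf_scale (of_nat (Suc m)) f = sf_scale (of_nat m) f + f"
      by (rule sf_eqI) (simp add: algebra_simps)
    with Suc show ?case by (simp add: algebra_simps)
  qed (auto intro!: sf_eqI)
  have "sf_scale (- x) f = - sf_scale x f" for x
    by (rule sf_eqI) simp
  then show ?thesis
    using * by (cases c rule: int_cases2) simp_all
qed

lemma sf_coeff_bij: "bij \<pi> \<Longrightarrow> sf_coeff f (image_mset \<pi> \<alpha>) = sf_coeff f \<alpha>"
  using sf_coeff[of f] by (simp add: is_symfun_def)

lemma finite_replicate_subset: "0 < r \<Longrightarrow> finite {i. replicate_mset r i \<subseteq># \<alpha>}"
  by (rule finite_subset[of _ "set_mset \<alpha>"]) (auto dest!: set_mset_mono split: if_splits)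

text \<open>A power sum contains only the monomials \<open>x\<^sub>i\<^sup>r\<close>, distinct for
  distinct \<open>i\<close> when \<open>0 < r\<close>, so the convolution runs over variables
  instead of submonomials.\<close>

lemma sf_coeff_power_sum_mult:
  assumes "0 < r"
  shows "sf_coeff (power_sum r * f) \<alpha> =
    (\<Sum>i | replicate_mset r i \<subseteq># \<alpha>. sf_coeff f (\<alpha> - replicate_mset r i))"
proof -
  have inj: "inj (replicate_mset r :: nat \<Rightarrow> nat multiset)"
  proof (rule injI)
    fix i j assume "replicate_mset r i = replicate_mset r j"
    then have "set_mset (replicate_mset r i) = set_mset (replicate_mset r j)" by simp
    then show "i = j" using assms by simp
  qed
  have "sf_coeff (power_sum r * f) \<alpha> =
     (\<Sum>\<beta> \<in> replicate_mset r ` {i. replicate_mset r i \<subseteq># \<alpha>}. sf_coeff f (\<alpha> - \<beta>))"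
    unfolding sf_coeff_mult
    by (rule sum.mono_neutral_cong_right) (auto simp: sf_coeff_power_sum finite_subset_mset)
  then show ?thesis
    by (simp add: sum.reindex inj_on_subset[OF inj])
qed

section \<open>Coefficients depend only on the multiset of exponents\<close>

text \<open>The parts of \<open>A \<union> B\<close> outside \<open>A\<close> and outside
  \<open>B\<close> have equal size, so a bijection between them completes \<open>f\<close>, with the
  identity elsewhere.\<close>

lemma ex_bij_extending:
  assumes f: "bij_betw f A B" and fin: "finite A" "finite B"
  obtains \<pi> :: "'a \<Rightarrow> 'a" where "bij \<pi>" "\<And>x. x \<in> A \<Longrightarrow> \<pi> x = f x"
proof -
  define C where "C = A \<union> B"
  have "card A = card B" using f by (rule bij_betw_same_card)
  then have "card (C - A) = card (C - B)"
    using fin by (simp add: C_def card_Diff_subset)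
  then obtain h where h: "bij_betw h (C - A) (C - B)"
    using fin finite_same_card_bij[of "C - A" "C - B"] by (auto simp: C_def)
  define \<pi> where "\<pi> x = (if x \<in> A then f x else if x \<in> C then h x else x)" for x
  have "bij_betw \<pi> (A \<union> ((C - A) \<union> - C)) (B \<union> ((C - B) \<union> - C))"
  proof (intro bij_betw_combine)
    show "bij_betw \<pi> A B" using f by (simp cong: bij_betw_cong add: \<pi>_def)
    show "bij_betw \<pi> (C - A) (C - B)" using h by (rule bij_betw_cong[THEN iffD1, rotated]) (simp add: \<pi>_def)
    have "bij_betw id (- C) (- C)" by simp
    then show "bij_betw \<pi> (- C) (- C)" by (rule bij_betw_cong[THEN iffD1, rotated]) (simp add: \<pi>_def C_def)
  qed (auto simp: C_def)
  moreover have "A \<union> ((C - A) \<union> - C) = UNIV" "B \<union> ((C - B) \<union> - C) = UNIV" by (auto simp: C_def)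
  ultimately have "bij \<pi>" by simp
  then show thesis by (rule that) (simp add: \<pi>_def)
qed

text \<open>Points are matched one at a time: \<open>x\<close> is sent to some \<open>y\<close> with
  the same value, and both are removed.\<close>

lemma ex_bij_betw_same_image_mset:
  assumes "image_mset f (mset_set A) = image_mset g (mset_set B)" "finite A" "finite B"
  shows "\<exists>h. bij_betw h A B \<and> (\<forall>x\<in>A. g (h x) = f x)"
  using assms(2,1,3)
proof (induction A arbitrary: B rule: finite_induct)
  case empty
  then have "B = {}" by (simp add: mset_set_empty_iff)
  then show ?case by (auto simp: bij_betw_def)
next
  case (insert x A)
  from insert.prems insert.hyps have eq: "image_mset g (mset_set B) = add_mset (f x) (image_mset f (mset_set A))"
    by simp
  then have "f x \<in># image_mset g (mset_set B)" by simp
  then obtain y where y: "y \<in> B" "g y = f x" using insert.prems(2) by auto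
  have "mset_set B = add_mset y (mset_set (B - {y}))"
    using mset_set.remove[OF insert.prems(2) y(1)] .
  then have "image_mset g (mset_set B) = add_mset (g y) (image_mset g (mset_set (B - {y})))" by simp
  with eq y(2) have "image_mset f (mset_set A) = image_mset g (mset_set (B - {y}))" by simp
  moreover have "finite (B - {y})" using insert.prems(2) by simp
  ultimately have "\<exists>h. bij_betw h A (B - {y}) \<and> (\<forall>x\<in>A. g (h x) = f x)" by (rule insert.IH)
  then obtain h where h: "bij_betw h A (B - {y})" "\<forall>x\<in>A. g (h x) = f x" by (elim exE conjE)
  have "bij_betw (h(x := y)) A (B - {y})"
    using h(1) by (rule bij_betw_cong[THEN iffD1, rotated]) (use insert.hyps in auto)
  then have "bij_betw (h(x := y)) ({x} \<union> A) ({y} \<union> (B - {y}))"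
    using bij_betw_combine[of "h(x := y)" "{x}" "{y}" A "B - {y}"] by (simp add: bij_betw_def)
  then have "bij_betw (h(x := y)) (insert x A) (insert y (B - {y}))" by simp
  then have "bij_betw (h(x := y)) (insert x A) B" using y(1) by (simp add: insert_absorb)
  moreover have "\<forall>z\<in>insert x A. g ((h(x := y)) z) = f z" using h(2) y(2) by simp
  ultimately show ?case by (intro exI[of _ "h(x := y)"] conjI)
qed

text \<open>Matching variables of equal exponent and extending the matching to a permutation of all
  variables carries \<open>\<alpha>\<close> to \<open>\<beta>\<close>; then symmetry
  applies.\<close>

lemma sf_coeff_exponents:
  assumes "exponents \<alpha> = exponents \<beta>"
  shows "sf_coeff f \<alpha> = sf_coeff f \<beta>"
proof -
  obtain h where h: "bij_betw h (set_mset \<alpha>) (set_mset \<beta>)" "\<forall>x\<in>set_mset \<alpha>. count \<beta> (h x) = count \<alpha> x"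
    using ex_bij_betw_same_image_mset[of "count \<alpha>" "set_mset \<alpha>" "count \<beta>" "set_mset \<beta>"] assms
    by (auto simp: exponents_def)
  obtain \<pi> where \<pi>: "bij \<pi>" "\<And>x. x \<in># \<alpha> \<Longrightarrow> \<pi> x = h x"
    using ex_bij_extending[OF h(1)] by auto
  have cnt: "count (image_mset \<pi> \<alpha>) (\<pi> i) = count \<alpha> i" for i
    using \<pi>(1) by (induction \<alpha>) (auto simp: inj_eq bij_is_inj)
  have "image_mset \<pi> \<alpha> = \<beta>"
  proof (rule multiset_eqI)
    fix y
    obtain i where i: "y = \<pi> i" using \<pi>(1) by (metis bij_pointE)
    show "count (image_mset \<pi> \<alpha>) y = count \<beta> y"
    proof (cases "i \<in># \<alpha>")
      case True
      then have "count \<beta> y = count \<alpha> i" using i h(2) \<pi>(2) by simp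
      then show ?thesis using i cnt by simp
    next
      case False
      have "y \<notin># \<beta>"
      proof
        assume "y \<in># \<beta>"
        then obtain j where "j \<in># \<alpha>" "h j = y" using h(1) by (metis bij_betw_iff_bijections)
        with \<pi> i have "\<pi> j = \<pi> i" by simp
        with \<pi>(1) have "j = i" by (auto simp: bij_is_inj inj_eq)
        with False \<open>j \<in># \<alpha>\<close> show False by simp
      qed
      then show ?thesis using False i cnt by (simp add: not_in_iff)
    qed
  qed
  then show ?thesis using sf_coeff_bij[OF \<pi>(1), of f \<alpha>] by simp
qed

lemma exponents_nonzero: "0 \<notin># exponents \<alpha>"
  by (auto simp: exponents_def simp flip: not_in_iff)

lemma size_exponents: "size (exponents \<alpha>) = card (set_mset \<alpha>)"
  by (simp add: exponents_def)

lemma exponents_add_replicate: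
  assumes "i \<notin># \<alpha>" "0 < r"
  shows "exponents (replicate_mset r i + \<alpha>) = add_mset r (exponents \<alpha>)"
proof -
  have "set_mset (replicate_mset r i + \<alpha>) = insert i (set_mset \<alpha>)" using assms by auto
  then have "exponents (replicate_mset r i + \<alpha>) =
     add_mset (count (replicate_mset r i + \<alpha>) i) (image_mset (count (replicate_mset r i + \<alpha>)) (mset_set (set_mset \<alpha>)))"
    using assms by (simp add: exponents_def)
  moreover have "image_mset (count (replicate_mset r i + \<alpha>)) (mset_set (set_mset \<alpha>)) = exponents \<alpha>"
    unfolding exponents_def using assms by (intro image_mset_cong) auto
  ultimately show ?thesis using assms by (simp add: not_in_iff)
qed

section \<open>Partitions as multisets\<close>

text \<open>Inverse of \<open>mset\<close> on partitions. Multisets of positive parts are the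
  handier index set for products, since adding or removing a part needs no sorting.\<close>

definition of_mset :: "nat multiset \<Rightarrow> nat list" where
  "of_mset M = rev (sorted_list_of_multiset M)"

lemma mset_of_mset [simp]: "mset (of_mset M) = M"
  by (simp add: of_mset_def)

lemma is_partition_of_mset: "0 \<notin># M \<Longrightarrow> is_partition (of_mset M)"
  by (simp add: of_mset_def is_partition_def sorted_wrt_rev)

lemma of_mset_mset: "is_partition \<nu> \<Longrightarrow> of_mset (mset \<nu>) = \<nu>"
proof -
  assume "is_partition \<nu>"
  then have "sorted (rev \<nu>)" by (simp add: is_partition_def sorted_wrt_rev)
  then have "sort (rev \<nu>) = rev \<nu>" by (simp add: sorted_sort_id)
  then have "sorted_list_of_multiset (mset \<nu>) = rev \<nu>"
    by (metis mset_rev sorted_list_of_multiset_mset)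
  then show ?thesis by (simp add: of_mset_def)
qed

lemma is_partition_mset_eq: "is_partition \<nu> \<Longrightarrow> is_partition \<mu> \<Longrightarrow> mset \<nu> = mset \<mu> \<longleftrightarrow> \<nu> = \<mu>"
  using of_mset_mset by metis

section \<open>Monomials and exponent sequences\<close>

text \<open>Exponent vectors may be unsorted and contain zeros, as happens in the expansion of the
  determinants.\<close>

definition monom_of :: "nat \<Rightarrow> (nat \<Rightarrow> nat) \<Rightarrow> nat multiset" where
  "monom_of n \<kappa> = (\<Sum>i<n. replicate_mset (\<kappa> i) i)"

lemma count_monom_of: "count (monom_of n \<kappa>) i = (if i < n then \<kappa> i else 0)"
  by (simp add: monom_of_def count_sum)

lemma set_mset_monom_of: "set_mset (monom_of n \<kappa>) = {i. i < n \<and> 0 < \<kappa> i}"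
  by (auto simp: set_mset_def count_monom_of)

lemma monom_of_cong: "(\<And>i. i < n \<Longrightarrow> \<kappa> i = \<kappa>' i) \<Longrightarrow> monom_of n \<kappa> = monom_of n \<kappa>'"
  by (simp add: monom_of_def)

lemma exponents_monom_of:
  "exponents (monom_of n \<kappa>) = filter_mset (\<lambda>x. x \<noteq> 0) (image_mset \<kappa> (mset_set {..<n}))"
proof (induction n)
  case 0
  then show ?case by (simp add: monom_of_def exponents_def)
next
  case (Suc n)
  have m: "monom_of (Suc n) \<kappa> = replicate_mset (\<kappa> n) n + monom_of n \<kappa>" by (simp add: monom_of_def)
  have "n \<notin># monom_of n \<kappa>" by (simp add: set_mset_monom_of)
  then show ?case using Suc exponents_add_replicate[of n "monom_of n \<kappa>" "\<kappa> n"]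
    by (cases "\<kappa> n = 0") (simp_all add: m lessThan_Suc)
qed

text \<open>The parts of a partition with at most \<open>n\<close> parts in increasing order, padded with zeros.\<close>

definition asc :: "nat \<Rightarrow> nat list \<Rightarrow> nat \<Rightarrow> nat" where
  "asc n \<nu> i = part \<nu> (n - i)"

lemma map_part:
  assumes "length \<nu> \<le> n"
  shows "map (\<lambda>i. part \<nu> (Suc i)) [0..<n] = \<nu> @ replicate (n - length \<nu>) 0"
  using assms by (intro nth_equalityI) (auto simp: part_def nth_append)

lemma image_asc: "image_mset (asc n \<nu>) (mset_set {..<n}) = mset (map (\<lambda>i. part \<nu> (Suc i)) [0..<n])"
proof -
  have "mset_set {..<n} = image_mset (\<lambda>i. n - Suc i) (mset_set {..<n})"
  proof (subst image_mset_mset_set)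
    show "inj_on (\<lambda>i. n - Suc i) {..<n}" by (auto simp: inj_on_def)
    have "(\<lambda>i. n - Suc i) ` {..<n} = {..<n}"
    proof (intro equalityI subsetI)
      fix x assume "x \<in> {..<n}"
      then show "x \<in> (\<lambda>i. n - Suc i) ` {..<n}" by (intro image_eqI[of _ _ "n - Suc x"]) auto
    qed auto
    then show "mset_set {..<n} = mset_set ((\<lambda>i. n - Suc i) ` {..<n})" by simp
  qed
  then have "image_mset (asc n \<nu>) (mset_set {..<n}) =
      image_mset (asc n \<nu>) (image_mset (\<lambda>i. n - Suc i) (mset_set {..<n}))"
    by (rule arg_cong)
  also have "\<dots> = image_mset (\<lambda>i. asc n \<nu> (n - Suc i)) (mset_set {..<n})"
    by (simp add: multiset.map_comp o_def)
  also have "\<dots> = image_mset (\<lambda>i. part \<nu> (Suc i)) (mset_set {..<n})"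
    by (intro image_mset_cong) (auto simp: asc_def)
  finally show ?thesis by (simp add: mset_map lessThan_atLeast0 mset_upt)
qed

lemma exponents_asc:
  assumes "is_partition \<nu>" "length \<nu> \<le> n"
  shows "exponents (monom_of n (asc n \<nu>)) = mset \<nu>"
proof -
  have "filter (\<lambda>x. x \<noteq> 0) (\<nu> @ replicate (n - length \<nu>) 0) = \<nu>"
    using assms(1) by (auto simp: is_partition_def filter_id_conv intro!: gr0I)
  then show ?thesis
    by (simp only: exponents_monom_of image_asc map_part[OF assms(2)] flip: mset_filter)
qed

lemma ex_exponents: "0 \<notin># M \<Longrightarrow> \<exists>\<alpha>. exponents \<alpha> = M"
  using exponents_asc[OF is_partition_of_mset, of M "length (of_mset M)"] by auto

section \<open>Expansion in monomial symmetric functions\<close>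

definition m_coeff :: "'a::comm_ring_1 symfun \<Rightarrow> nat list \<Rightarrow> 'a" where
  "m_coeff f \<nu> = sf_coeff f (monom_of (length \<nu>) (asc (length \<nu>) \<nu>))"

lemma m_coeff_eq:
  assumes "is_partition \<nu>" "exponents \<alpha> = mset \<nu>"
  shows "m_coeff f \<nu> = sf_coeff f \<alpha>"
  unfolding m_coeff_def using assms by (intro sf_coeff_exponents) (simp add: exponents_asc)

text \<open>Bounded degree leaves finitely many partitions, and at a given monomial only the
  \<open>m\<^sub>\<nu>\<close> with the same exponents is nonzero.\<close>

lemma monomial_expansion:
  fixes f :: "'a::comm_ring_1 symfun"
  shows "\<exists>T. finite T \<and> (\<forall>\<nu>\<in>T. is_partition \<nu> \<and> m_coeff f \<nu> \<noteq> 0) \<and>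
    f = (\<Sum>\<nu>\<in>T. sf_scale (m_coeff f \<nu>) (monomial_sf \<nu>))"
proof -
  define T where "T = {\<nu>. is_partition \<nu> \<and> m_coeff f \<nu> \<noteq> 0}"
  obtain d where d: "\<And>\<alpha>. sf_coeff f \<alpha> \<noteq> 0 \<Longrightarrow> size \<alpha> \<le> d"
    using sf_coeff[of f] unfolding is_symfun_def by auto
  have "T \<subseteq> (\<Union>n\<le>d. {\<mu>. is_partition \<mu> \<and> sum_list \<mu> = n})"
  proof
    fix \<nu> assume \<nu>: "\<nu> \<in> T"
    let ?\<alpha> = "monom_of (length \<nu>) (asc (length \<nu>) \<nu>)"
    have "size ?\<alpha> = sum_list \<nu>"
      using \<nu> sum_mset_exponents[of ?\<alpha>] by (simp add: T_def exponents_asc sum_mset_sum_list)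
    then show "\<nu> \<in> (\<Union>n\<le>d. {\<mu>. is_partition \<mu> \<and> sum_list \<mu> = n})"
      using \<nu> d[of ?\<alpha>] by (simp add: T_def m_coeff_def)
  qed
  then have fin: "finite T" by (rule finite_subset) (auto simp: finite_partitions)
  have "f = (\<Sum>\<nu>\<in>T. sf_scale (m_coeff f \<nu>) (monomial_sf \<nu>))"
  proof (rule sf_eqI)
    fix \<alpha>
    define \<nu> where "\<nu> = of_mset (exponents \<alpha>)"
    have \<nu>: "is_partition \<nu>" "mset \<nu> = exponents \<alpha>"
      by (auto simp: \<nu>_def is_partition_of_mset exponents_nonzero)
    have m: "m_coeff f \<nu> = sf_coeff f \<alpha>" using \<nu> by (simp add: m_coeff_eq)
    have "sf_coeff (\<Sum>\<nu>\<in>T. sf_scale (m_coeff f \<nu>) (monomial_sf \<nu>)) \<alpha> =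
        (\<Sum>\<mu>\<in>T. if \<mu> = \<nu> then m_coeff f \<nu> else 0)"
      by (simp add: sf_coeff_monomial_sf \<nu>(2)[symmetric], intro sum.cong)
        (auto simp: T_def is_partition_mset_eq[OF \<nu>(1)])
    also have "\<dots> = (if \<nu> \<in> T then m_coeff f \<nu> else 0)" using fin by simp
    also have "\<dots> = sf_coeff f \<alpha>" using \<nu> m by (auto simp: T_def)
    finally show "sf_coeff f \<alpha> = sf_coeff (\<Sum>\<nu>\<in>T. sf_scale (m_coeff f \<nu>) (monomial_sf \<nu>)) \<alpha>" by simp
  qed
  with fin show ?thesis by (intro exI[of _ T]) (auto simp: T_def)
qed

section \<open>The basis of power sums\<close>

definition pm :: "nat multiset \<Rightarrow> 'a::comm_ring_1 symfun" where
  "pm M = (\<Prod>r\<in>#M. power_sum r)"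

lemma pm_simps [simp]: "pm {#} = 1" "pm (add_mset r M) = power_sum r * pm M"
  by (simp_all add: pm_def)

lemma power_sum_part_eq_pm: "power_sum_part \<nu> = pm (mset \<nu>)"
  by (simp add: power_sum_part_def pm_def flip: mset_map prod_mset_prod_list)

text \<open>A monomial of the product arises by giving each part of \<open>M\<close> to a variable.
  If two parts share a variable, there are fewer variables than parts; otherwise the exponents are
  \<open>M\<close>. Natural-number coefficients exclude cancellation.\<close>

lemma sf_coeff_pm:
  assumes "0 \<notin># M"
  shows "\<exists>c::nat. sf_coeff (pm M) \<alpha> = of_nat c \<and> (exponents \<alpha> = M \<longrightarrow> c \<noteq> 0) \<and>
    (c \<noteq> 0 \<longrightarrow> card (set_mset \<alpha>) < size M \<or> exponents \<alpha> = M)"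
  using assms
proof (induction M arbitrary: \<alpha>)
  case empty
  then show ?case by (intro exI[of _ "if \<alpha> = {#} then 1 else 0"]) (auto simp: exponents_def mset_set_empty_iff)
next
  case (add r M)
  then have r: "0 < r" and M: "0 \<notin># M" by auto
  have "\<forall>\<beta>. \<exists>c::nat. sf_coeff (pm M) \<beta> = (of_nat c :: 'a) \<and> (exponents \<beta> = M \<longrightarrow> c \<noteq> 0) \<and>
      (c \<noteq> 0 \<longrightarrow> card (set_mset \<beta>) < size M \<or> exponents \<beta> = M)"
    using add.IH[OF M] by blast
  then obtain C :: "nat multiset \<Rightarrow> nat" where
    C: "\<And>\<beta>. sf_coeff (pm M) \<beta> = (of_nat (C \<beta>) :: 'a)"
       "\<And>\<beta>. exponents \<beta> = M \<Longrightarrow> C \<beta> \<noteq> 0"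
       "\<And>\<beta>. C \<beta> \<noteq> 0 \<Longrightarrow> card (set_mset \<beta>) < size M \<or> exponents \<beta> = M"
    unfolding choice_iff by auto
  let ?I = "{i. replicate_mset r i \<subseteq># \<alpha>}"
  define c where "c = (\<Sum>i\<in>?I. C (\<alpha> - replicate_mset r i))"
  have fin: "finite ?I" using r by (rule finite_replicate_subset)
  have split: "replicate_mset r i + (\<alpha> - replicate_mset r i) = \<alpha>" if "i \<in> ?I" for i
    using that by (auto simp: subset_mset.add_diff_inverse)
  have "sf_coeff (pm (add_mset r M)) \<alpha> = (of_nat c :: 'a)"
    by (simp add: sf_coeff_power_sum_mult r C(1) c_def)
  moreover have "c \<noteq> 0" if "exponents \<alpha> = add_mset r M"
  proof -
    from that have "r \<in># exponents \<alpha>" by simp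
    \<comment> \<open>The part \<open>r\<close> is given to a variable of exponent exactly
      \<open>r\<close>, which then disappears from the quotient.\<close>
    then obtain i where i: "i \<in># \<alpha>" "count \<alpha> i = r" by (auto simp: exponents_def)
    then have I: "i \<in> ?I" by (auto intro: mset_subset_eqI)
    have "i \<notin># \<alpha> - replicate_mset r i" using i by (simp add: count_eq_zero_iff[symmetric])
    from exponents_add_replicate[OF this r] split[OF I] that
    have "exponents (\<alpha> - replicate_mset r i) = M" by simp
    then have "C (\<alpha> - replicate_mset r i) \<noteq> 0" by (rule C(2))
    with fin I show ?thesis unfolding c_def by (auto simp: sum_eq_0_iff)
  qed
  moreover have "card (set_mset \<alpha>) < size (add_mset r M) \<or> exponents \<alpha> = add_mset r M" if c0: "c \<noteq> 0"
  proof -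
    have "\<exists>i\<in>?I. C (\<alpha> - replicate_mset r i) \<noteq> 0"
      using c0 unfolding c_def by (rule contrapos_np) (simp add: sum.neutral)
    then obtain i where I: "i \<in> ?I" and "C (\<alpha> - replicate_mset r i) \<noteq> 0" by (elim bexE)
    let ?\<beta> = "\<alpha> - replicate_mset r i"
    from C(3)[OF \<open>C ?\<beta> \<noteq> 0\<close>] have \<beta>: "card (set_mset ?\<beta>) < size M \<or> exponents ?\<beta> = M" .
    then have cb: "card (set_mset ?\<beta>) \<le> size M" using size_exponents[of ?\<beta>] by auto
    have set: "set_mset \<alpha> = insert i (set_mset ?\<beta>)"
      by (subst split[OF I, symmetric]) (use r in auto)
    show ?thesis
    proof (cases "i \<in># ?\<beta>")
      case True
      then have "set_mset \<alpha> = set_mset ?\<beta>" using set by (simp add: insert_absorb)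
      then show ?thesis using cb by simp
    next
      case False
      from False have "card (set_mset \<alpha>) = Suc (card (set_mset ?\<beta>))" by (simp add: set)
      moreover have "exponents \<alpha> = add_mset r (exponents ?\<beta>)"
        using exponents_add_replicate[OF False r] split[OF I] by simp
      ultimately show ?thesis using \<beta> by auto
    qed
  qed
  ultimately show ?case by (intro exI[of _ c]) simp
qed

lemma pm_coeff_nonzero:
  fixes M :: "nat multiset"
  assumes "0 \<notin># M" "sf_coeff (pm M) \<alpha> \<noteq> (0::'a::comm_ring_1)"
  shows "card (set_mset \<alpha>) < size M \<or> exponents \<alpha> = M"
proof -
  obtain c :: nat where "sf_coeff (pm M) \<alpha> = (of_nat c :: 'a)"
    "c \<noteq> 0 \<longrightarrow> card (set_mset \<alpha>) < size M \<or> exponents \<alpha> = M"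
    using sf_coeff_pm[OF assms(1)] by blast
  with assms(2) show ?thesis by auto
qed

lemma pm_coeff_self:
  fixes M :: "nat multiset"
  assumes "0 \<notin># M" "exponents \<alpha> = M"
  shows "sf_coeff (pm M) \<alpha> \<noteq> (0::'a::{comm_ring_1,ring_char_0})"
proof -
  obtain c :: nat where "sf_coeff (pm M) \<alpha> = (of_nat c :: 'a)" "exponents \<alpha> = M \<longrightarrow> c \<noteq> 0"
    using sf_coeff_pm[OF assms(1)] by blast
  with assms(2) show ?thesis by auto
qed

text \<open>Take \<open>N\<close> of maximal size among the indices with nonzero coefficient. A
  monomial with exponents \<open>N\<close> has as many variables as \<open>N\<close> has parts, so
  by triangularity no other product in the relation contains it.\<close>

lemma pm_sum_eq_0:
  fixes u :: "nat multiset \<Rightarrow> 'a::field_char_0"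
  assumes "finite T" "\<And>M. M \<in> T \<Longrightarrow> 0 \<notin># M" "(\<Sum>M\<in>T. sf_scale (u M) (pm M)) = 0" "M \<in> T"
  shows "u M = 0"
proof (rule ccontr)
  assume "u M \<noteq> 0"
  define U where "U = {M \<in> T. u M \<noteq> 0}"
  have "finite U" "U \<noteq> {}" using assms(1,4) \<open>u M \<noteq> 0\<close> by (auto simp: U_def)
  then have "Max (size ` U) \<in> size ` U" by simp
  then obtain N where "N \<in> U" "Max (size ` U) = size N" by (elim imageE)
  then have N: "N \<in> U" "\<And>N'. N' \<in> U \<Longrightarrow> size N' \<le> size N"
    using \<open>finite U\<close> Max_ge[of "size ` U"] by auto
  have N0: "N \<in> T" "0 \<notin># N" "u N \<noteq> 0" using N(1) assms(2) by (auto simp: U_def)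
  obtain \<alpha> where \<alpha>: "exponents \<alpha> = N" using ex_exponents[OF N0(2)] by auto
  have cardN: "card (set_mset \<alpha>) = size N" using \<alpha> size_exponents[of \<alpha>] by simp
  have "sf_coeff (pm N') \<alpha> = (0::'a)" if "N' \<in> U" "N' \<noteq> N" for N'
  proof (rule ccontr)
    assume "sf_coeff (pm N') \<alpha> \<noteq> (0::'a)"
    moreover have "0 \<notin># N'" using that(1) assms(2) by (auto simp: U_def)
    ultimately have "card (set_mset \<alpha>) < size N' \<or> exponents \<alpha> = N'" by (intro pm_coeff_nonzero)
    with cardN N(2)[OF that(1)] that(2) \<alpha> show False by auto
  qed
  then have "u M * sf_coeff (pm M) \<alpha> = (if M = N then u N * sf_coeff (pm N) \<alpha> else 0)" if "M \<in> T" for M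
    using that by (cases "u M = 0") (auto simp: U_def)
  then have "(\<Sum>M\<in>T. u M * sf_coeff (pm M) \<alpha>) = (\<Sum>M\<in>T. if M = N then u N * sf_coeff (pm N) \<alpha> else 0)"
    by (intro sum.cong) auto
  also have "\<dots> = u N * sf_coeff (pm N) \<alpha>" using assms(1) N0 by simp
  finally have "sf_coeff (\<Sum>M\<in>T. sf_scale (u M) (pm M)) \<alpha> = u N * sf_coeff (pm N) \<alpha>" by simp
  then show False using assms(3) N0 pm_coeff_self[OF N0(2) \<alpha>, where 'a = 'a] by simp
qed

text \<open>Otherwise \<open>pm M - pm N = 0\<close> would be a nontrivial relation. Injectivity
  matters because coordinates are attached to the basis vectors, not to their indices.\<close>

lemma inj_pm: "inj_on (pm :: _ \<Rightarrow> 'a::field_char_0 symfun) {M. 0 \<notin># M}"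
proof (rule inj_onI, rule ccontr)
  fix M N assume *: "M \<in> {M. 0 \<notin># M}" "N \<in> {M. 0 \<notin># M}" "pm M = (pm N :: 'a symfun)" "M \<noteq> N"
  have "(\<Sum>L\<in>{M, N}. sf_scale (if L = M then 1 else - 1) (pm L)) = (0 :: 'a symfun)"
    using * by (simp add: symfun.scale_minus_left)
  from pm_sum_eq_0[OF _ _ this, of M] * show False by auto
qed

definition pm_basis :: "'a::comm_ring_1 symfun set" where
  "pm_basis = pm ` {M. 0 \<notin># M}"

lemma power_sum_part_image: "power_sum_part ` {\<mu>. is_partition \<mu>} = pm_basis"
proof -
  have "pm M \<in> power_sum_part ` {\<mu>. is_partition \<mu>}" if "0 \<notin># M" for M
    using is_partition_of_mset[OF that] by (intro image_eqI[of _ _ "of_mset M"]) (auto simp: power_sum_part_eq_pm)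
  then show ?thesis by (auto simp: pm_basis_def power_sum_part_eq_pm is_partition_def)
qed

lemma independent_pm: "symfun.independent (pm_basis :: 'a::field_char_0 symfun set)"
  unfolding symfun.independent_explicit_module
proof (intro allI impI)
  fix t u v assume t: "finite t" "t \<subseteq> (pm_basis :: 'a symfun set)" "(\<Sum>v\<in>t. sf_scale (u v) v) = 0" "v \<in> t"
  define T where "T = {M. 0 \<notin># M \<and> pm M \<in> t}"
  have T: "t = pm ` T" using t(2) by (auto simp: T_def pm_basis_def)
  have inj: "inj_on (pm :: _ \<Rightarrow> 'a symfun) T" using inj_pm by (rule inj_on_subset) (auto simp: T_def)
  have "finite T" using t(1) T inj finite_imageD by blast
  have "(\<Sum>M\<in>T. sf_scale (u (pm M)) (pm M)) = 0" using t(3) by (simp add: T sum.reindex[OF inj])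
  moreover obtain M where "M \<in> T" "v = pm M" using t(4) T by blast
  moreover have "0 \<notin># M" if "M \<in> T" for M using that by (simp add: T_def)
  ultimately show "u v = 0" using pm_sum_eq_0[OF \<open>finite T\<close>, of "\<lambda>M. u (pm M)" M] by simp
qed

text \<open>By triangularity the product of power sums is a nonzero multiple of
  \<open>m\<^sub>\<nu>\<close> plus terms \<open>m\<^sub>\<mu>\<close> with fewer parts; solving for
  \<open>m\<^sub>\<nu>\<close> gives the induction.\<close>

lemma monomial_sf_in_span_pm:
  assumes "is_partition \<nu>"
  shows "monomial_sf \<nu> \<in> symfun.span (pm_basis :: 'a::field_char_0 symfun set)"
  using assms
proof (induction "length \<nu>" arbitrary: \<nu> rule: less_induct)
  case less
  let ?M = "mset \<nu>" and ?p = "pm (mset \<nu>) :: 'a symfun"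
  have M0: "0 \<notin># ?M" using less.prems by (simp add: is_partition_def)
  obtain T where T: "finite T" "\<forall>\<mu>\<in>T. is_partition \<mu> \<and> m_coeff ?p \<mu> \<noteq> 0"
    "?p = (\<Sum>\<mu>\<in>T. sf_scale (m_coeff ?p \<mu>) (monomial_sf \<mu>))"
    using monomial_expansion[of ?p] by blast
  define c where "c = m_coeff ?p"
  obtain \<alpha> where \<alpha>: "exponents \<alpha> = ?M" using ex_exponents[OF M0] by auto
  have c\<nu>: "c \<nu> \<noteq> 0"
    using pm_coeff_self[OF M0 \<alpha>, where 'a = 'a] by (simp add: c_def m_coeff_eq[OF less.prems \<alpha>])
  have \<nu>T: "\<nu> \<in> T"
  proof (rule ccontr)
    assume "\<nu> \<notin> T"
    have "sf_coeff ?p \<alpha> = (\<Sum>\<mu>\<in>T. sf_coeff (sf_scale (c \<mu>) (monomial_sf \<mu>)) \<alpha>)"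
      by (subst T(3)) (simp add: c_def)
    also have "\<dots> = 0"
      using T(2) \<open>\<nu> \<notin> T\<close> is_partition_mset_eq[OF less.prems]
      by (intro sum.neutral) (auto simp: sf_coeff_monomial_sf \<alpha>)
    finally show False using pm_coeff_self[OF M0 \<alpha>, where 'a = 'a] by simp
  qed
  have "?p = sf_scale (c \<nu>) (monomial_sf \<nu>) + (\<Sum>\<mu>\<in>T - {\<nu>}. sf_scale (c \<mu>) (monomial_sf \<mu>))"
    by (subst T(3)) (simp add: c_def sum.remove[OF T(1) \<nu>T])
  then have "monomial_sf \<nu> = sf_scale (inverse (c \<nu>)) (?p - (\<Sum>\<mu>\<in>T - {\<nu>}. sf_scale (c \<mu>) (monomial_sf \<mu>)))"
    using c\<nu> by (simp add: symfun.scale_right_diff_distrib)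
  moreover have "?p \<in> symfun.span pm_basis"
    by (rule symfun.span_base) (use M0 in \<open>simp add: pm_basis_def\<close>)
  moreover have "monomial_sf \<mu> \<in> symfun.span (pm_basis :: 'a symfun set)" if \<mu>: "\<mu> \<in> T - {\<nu>}" for \<mu>
  proof (rule less.hyps)
    let ?\<beta> = "monom_of (length \<mu>) (asc (length \<mu>) \<mu>)"
    have "is_partition \<mu>" "sf_coeff ?p ?\<beta> \<noteq> 0" using T(2) \<mu> by (auto simp: m_coeff_def)
    with pm_coeff_nonzero[OF M0, of ?\<beta>, where 'a = 'a] size_exponents[of ?\<beta>]
      is_partition_mset_eq[OF _ less.prems, of \<mu>] \<mu>
    show "length \<mu> < length \<nu>" by (auto simp: exponents_asc)
  qed (use T(2) \<mu> in auto)
  ultimately show ?case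
    by (auto intro!: symfun.span_scale symfun.span_diff symfun.span_sum)
qed

lemma span_pm: "symfun.span (pm_basis :: 'a::field_char_0 symfun set) = UNIV"
proof -
  have "f \<in> symfun.span pm_basis" for f :: "'a symfun"
  proof -
    obtain T where T: "\<forall>\<nu>\<in>T. is_partition \<nu> \<and> m_coeff f \<nu> \<noteq> 0"
      "f = (\<Sum>\<nu>\<in>T. sf_scale (m_coeff f \<nu>) (monomial_sf \<nu>))"
      using monomial_expansion[of f] by blast
    show ?thesis
      by (subst T(2)) (use T(1) in \<open>auto intro!: symfun.span_sum symfun.span_scale monomial_sf_in_span_pm\<close>)
  qed
  then show ?thesis by auto
qed

section \<open>The bilinear form\<close>

text \<open>Makes the results on the power sum basis available over \<open>ratfun\<close>.\<close>

instance fract :: ("{idom,ring_char_0}") field_char_0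
proof
  show "inj (of_nat :: nat \<Rightarrow> 'a fract)"
    by (rule injI) (simp add: of_nat_fract eq_fract)
qed

text \<open>Linear statements need only be checked on products of power sums, because these
  span.\<close>

lemma pm_induct [case_names zero pm add]:
  fixes f :: "'a::field_char_0 symfun"
  assumes "P 0" "\<And>M. 0 \<notin># M \<Longrightarrow> P (pm M)" "\<And>c f g. P f \<Longrightarrow> P g \<Longrightarrow> P (sf_scale c f + g)"
  shows "P f"
proof -
  have "f \<in> symfun.span pm_basis" by (simp add: span_pm)
  then show ?thesis
  proof (induction f rule: symfun.span_induct_alt)
    case (step c x y)
    then obtain M where "x = pm M" "0 \<notin># M" by (auto simp: pm_basis_def)
    with assms(2,3) step show ?case by blast
  qed (rule assms(1))
qed

definition coord :: "'a::field_char_0 symfun \<Rightarrow> nat multiset \<Rightarrow> 'a" where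
  "coord f M = symfun.representation pm_basis f (pm M)"

lemma coord_linear: "coord (sf_scale c f + g) M = c * coord f M + coord g M"
  by (simp add: coord_def symfun.representation_add symfun.representation_scale independent_pm span_pm)

lemma coord_zero [simp]: "coord 0 M = 0"
  by (simp add: coord_def symfun.representation_zero)

lemma coord_pm:
  assumes "0 \<notin># M" "0 \<notin># N"
  shows "coord (pm N) M = (if M = N then 1 else 0 :: 'a::field_char_0)"
proof -
  have "(pm N :: 'a symfun) \<in> pm_basis" using assms by (simp add: pm_basis_def)
  then show ?thesis
    using assms inj_pm[where 'a = 'a]
    by (auto simp: coord_def symfun.representation_basis independent_pm inj_on_def)
qed

lemma finite_coord: "finite {M. 0 \<notin># M \<and> coord f M \<noteq> (0::'a::field_char_0)}"
proof -
  have "finite (pm ` {M. 0 \<notin># M \<and> coord f M \<noteq> 0} :: 'a symfun set)"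
    by (rule finite_subset[OF _ symfun.finite_representation[of pm_basis f]]) (auto simp: coord_def)
  then show ?thesis
    by (rule finite_imageD) (rule inj_on_subset[OF inj_pm], auto)
qed

definition zm :: "nat multiset \<Rightarrow> nat" where
  "zm M = (\<Prod>j\<in>set_mset M. j ^ count M j * fact (count M j))"

lemma z_part_eq_zm: "z_part \<nu> = zm (mset \<nu>)"
  by (simp add: z_part_def zm_def count_mset)

text \<open>One more part \<open>r\<close> multiplies the power of \<open>r\<close> by
  \<open>r\<close> and the factorial by \<open>Suc (count M r)\<close>. This recursion is what makes
  \<open>ps_adj\<close> the adjoint of a power sum.\<close>

lemma zm_add: "zm (add_mset r M) = r * Suc (count M r) * zm M"
proof -
  let ?f = "\<lambda>M j. j ^ count M j * fact (count M j) :: nat"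
  have z: "zm N = (\<Prod>j\<in>insert r (set_mset M). ?f N j)" if "set_mset N \<subseteq> insert r (set_mset M)" for N
    unfolding zm_def by (rule prod.mono_neutral_left) (use that in \<open>auto simp: not_in_iff\<close>)
  have "zm N = ?f N r * (\<Prod>j\<in>set_mset M - {r}. ?f N j)" if "set_mset N \<subseteq> insert r (set_mset M)" for N
    using z[OF that] by (simp add: prod.insert_remove)
  from this[of M] this[of "add_mset r M"]
  have "zm M = ?f M r * (\<Prod>j\<in>set_mset M - {r}. ?f M j)"
    "zm (add_mset r M) = ?f (add_mset r M) r * (\<Prod>j\<in>set_mset M - {r}. ?f M j)" by auto
  then show ?thesis by (simp add: algebra_simps)
qed

definition wt :: "nat multiset \<Rightarrow> ratfun" where
  "wt M = kk ^ size M * of_nat (zm M)"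

lemma partition_nonzero: "is_partition \<nu> \<Longrightarrow> 0 \<notin> set \<nu>"
  by (simp add: is_partition_def)

text \<open>Any finite index set covering the support of \<open>f\<close> may be used, so the sums
  for several functions can be taken over one set.\<close>

lemma jack_inner_coord:
  assumes "finite S" "\<And>M. 0 \<notin># M \<Longrightarrow> coord f M \<noteq> 0 \<Longrightarrow> M \<in> S" "\<And>M. M \<in> S \<Longrightarrow> 0 \<notin># M"
  shows "jack_inner f g = (\<Sum>M\<in>S. coord f M * coord g M * wt M)"
proof -
  have c: "power_sum_coord f \<nu> = coord f (mset \<nu>)" for f \<nu>
    unfolding power_sum_coord_def coord_def power_sum_part_image by (simp add: power_sum_part_eq_pm)
  have "jack_inner f g = (\<Sum>M\<in>{M. 0 \<notin># M \<and> coord f M \<noteq> 0}. coord f M * coord g M * wt M)"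
    unfolding jack_inner_def c
    by (rule sum.reindex_bij_witness[where i = of_mset and j = mset])
      (auto simp: of_mset_mset is_partition_of_mset wt_def z_part_eq_zm partition_nonzero)
  also have "\<dots> = (\<Sum>M\<in>S. coord f M * coord g M * wt M)"
    using assms by (intro sum.mono_neutral_left) auto
  finally show ?thesis .
qed

lemma jack_inner_common_support:
  "\<exists>S. \<forall>h\<in>{f, g, k}. \<forall>h'. jack_inner h h' = (\<Sum>M\<in>S. coord h M * coord h' M * wt M)"
proof -
  let ?S = "{M. 0 \<notin># M \<and> coord f M \<noteq> 0} \<union> {M. 0 \<notin># M \<and> coord g M \<noteq> 0} \<union> {M. 0 \<notin># M \<and> coord k M \<noteq> 0}"
  have "finite ?S" by (simp add: finite_coord)
  then have "jack_inner h h' = (\<Sum>M\<in>?S. coord h M * coord h' M * wt M)" if "h \<in> {f, g, k}" for h h'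
    using that by (intro jack_inner_coord) auto
  then show ?thesis by blast
qed

lemma jack_inner_commute: "jack_inner f g = jack_inner g f"
  using jack_inner_common_support[of f g f] by (auto simp: mult.commute)

lemma jack_inner_linear: "jack_inner (sf_scale c f + g) h = c * jack_inner f h + jack_inner g h"
proof -
  obtain S where "\<forall>k\<in>{f, g, sf_scale c f + g}. \<forall>h. jack_inner k h = (\<Sum>M\<in>S. coord k M * coord h M * wt M)"
    using jack_inner_common_support by blast
  then have "jack_inner f h = (\<Sum>M\<in>S. coord f M * coord h M * wt M)"
    "jack_inner g h = (\<Sum>M\<in>S. coord g M * coord h M * wt M)"
    "jack_inner (sf_scale c f + g) h = (\<Sum>M\<in>S. coord (sf_scale c f + g) M * coord h M * wt M)"
    by blast+
  then show ?thesis by (simp only: coord_linear sum_distrib_left distrib_right sum.distrib mult.assoc)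
qed

lemma jack_inner_0 [simp]: "jack_inner 0 h = 0" "jack_inner h 0 = 0"
  using jack_inner_coord[of "{}" 0 h] by (simp_all add: jack_inner_commute[of h])

lemma jack_inner_scale [simp]:
  "jack_inner (sf_scale c f) h = c * jack_inner f h" "jack_inner h (sf_scale c f) = c * jack_inner h f"
  using jack_inner_linear[of c f 0 h] by (simp_all add: jack_inner_commute[of h])

lemma jack_inner_add [simp]:
  "jack_inner (f + g) h = jack_inner f h + jack_inner g h" "jack_inner h (f + g) = jack_inner h f + jack_inner h g"
  using jack_inner_linear[of 1 f g h] by (simp_all add: jack_inner_commute[of h])

lemma jack_inner_diff [simp]:
  "jack_inner (f - g) h = jack_inner f h - jack_inner g h" "jack_inner h (f - g) = jack_inner h f - jack_inner h g"
  using jack_inner_linear[of "-1" g f h] by (simp_all add: jack_inner_commute[of h])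

lemma jack_inner_sum [simp]:
  "jack_inner (sum f A) h = (\<Sum>x\<in>A. jack_inner (f x) h)" "jack_inner h (sum f A) = (\<Sum>x\<in>A. jack_inner h (f x))"
  by (induction A rule: infinite_finite_induct) simp_all

lemma jack_inner_pm:
  assumes "0 \<notin># M" "0 \<notin># N"
  shows "jack_inner (pm M) (pm N) = (if M = N then wt M else 0)"
  using assms by (subst jack_inner_coord[of "{M}"]) (auto simp: coord_pm split: if_splits)

section \<open>The adjoint of multiplication by a power sum\<close>

interpretation sf_pair: vector_space_pair sf_scale sf_scale ..

text \<open>As a derivation, this operator is \<open>k r \<partial>/\<partial>p\<^sub>r\<close>.\<close>

definition ps_adj :: "nat \<Rightarrow> ratfun symfun \<Rightarrow> ratfun symfun" where
  "ps_adj r = (SOME D. Vector_Spaces.linear sf_scale sf_scale D \<and>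
     (\<forall>M. 0 \<notin># M \<longrightarrow> D (pm M) = sf_scale (kk * of_nat (r * count M r)) (pm (M - {#r#}))))"

lemma ps_adj_ex:
  "Vector_Spaces.linear sf_scale sf_scale (ps_adj r) \<and>
     (\<forall>M. 0 \<notin># M \<longrightarrow> ps_adj r (pm M) = sf_scale (kk * of_nat (r * count M r)) (pm (M - {#r#})))"
proof -
  \<comment> \<open>Injectivity of \<open>pm\<close> recovers \<open>M\<close> from the basis
    vector. If \<open>r\<close> is not in \<open>M\<close>, the factor \<open>count M r\<close> is
    0, so the truncating difference is harmless.\<close>
  define d :: "ratfun symfun \<Rightarrow> ratfun symfun" where "d b = (let M = the_inv_into {M. 0 \<notin># M} pm b in
    sf_scale (kk * of_nat (r * count M r)) (pm (M - {#r#})))" for b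
  have "d (pm M) = sf_scale (kk * of_nat (r * count M r)) (pm (M - {#r#}))" if "0 \<notin># M" for M
    using that the_inv_into_f_f[OF inj_pm[where 'a = ratfun], of M] by (simp add: d_def)
  moreover obtain D where "Vector_Spaces.linear sf_scale sf_scale D" "\<forall>b\<in>pm_basis. D b = d b"
    using sf_pair.linear_independent_extend[OF independent_pm, of d] by blast
  ultimately have "\<exists>D. Vector_Spaces.linear sf_scale sf_scale D \<and>
     (\<forall>M. 0 \<notin># M \<longrightarrow> D (pm M) = sf_scale (kk * of_nat (r * count M r)) (pm (M - {#r#})))"
    by (intro exI[of _ D]) (auto simp: pm_basis_def)
  then show ?thesis unfolding ps_adj_def by (rule someI_ex)
qed

lemma ps_adj_pm: "0 \<notin># M \<Longrightarrow> ps_adj r (pm M) = sf_scale (kk * of_nat (r * count M r)) (pm (M - {#r#}))"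
  using ps_adj_ex by blast

lemma ps_adj_simps [simp]:
  "ps_adj r (f + g) = ps_adj r f + ps_adj r g" "ps_adj r (sf_scale c f) = sf_scale c (ps_adj r f)" 
  "ps_adj r 0 = 0" "ps_adj r 1 = 0"
proof -
  interpret D: Vector_Spaces.linear sf_scale sf_scale "ps_adj r" using ps_adj_ex by blast
  show "ps_adj r (f + g) = ps_adj r f + ps_adj r g" "ps_adj r (sf_scale c f) = sf_scale c (ps_adj r f)" "ps_adj r 0 = 0"
    by (simp_all add: D.add D.scale D.zero)
  show "ps_adj r 1 = 0" using ps_adj_pm[of "{#}" r] by simp
qed

lemma ps_adj_sum [simp]: "ps_adj r (sum f A) = (\<Sum>x\<in>A. ps_adj r (f x))"
  by (induction A rule: infinite_finite_induct) simp_all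

lemma pm_union: "pm (M + N) = pm M * pm N"
  by (simp add: pm_def)

text \<open>Both sides are bilinear, and on products of power sums the rule reduces to additivity of
  \<open>count\<close> in the multiset.\<close>

lemma ps_adj_mult: "ps_adj r (f * g) = ps_adj r f * g + f * ps_adj r g"
proof (induction f rule: pm_induct)
  case (pm M)
  show ?case
  proof (induction g rule: pm_induct)
    case (pm N)
    have *: "sf_scale (of_nat (count L r)) (pm (L - {#r#})) * pm K = sf_scale (of_nat (count L r)) (pm (L + K - {#r#}) :: ratfun symfun)"
      for L K
      by (cases "r \<in># L") (simp_all add: not_in_iff flip: sf_scale_mult_left pm_union)
    have "ps_adj r (pm M * pm N) = sf_scale (kk * of_nat r) (sf_scale (of_nat (count M r)) (pm (M + N - {#r#})) + sf_scale (of_nat (count N r)) (pm (N + M - {#r#})))"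
      using ps_adj_pm[of "M + N" r] \<open>0 \<notin># M\<close> \<open>0 \<notin># N\<close>
      by (simp add: pm_union algebra_simps symfun.scale_left_distrib)
    also have "\<dots> = ps_adj r (pm M) * pm N + pm M * ps_adj r (pm N)"
      using \<open>0 \<notin># M\<close> \<open>0 \<notin># N\<close>
      by (simp add: ps_adj_pm mult.commute[of "pm M"] symfun.scale_right_distrib sf_scale_mult mult.assoc flip: *)
    finally show ?case .
  qed (simp_all add: algebra_simps sf_scale_mult symfun.scale_right_distrib)
qed (simp_all add: algebra_simps sf_scale_mult symfun.scale_right_distrib)

lemma ps_adj_prod:
  assumes "finite A"
  shows "ps_adj r (prod f A) = (\<Sum>i\<in>A. ps_adj r (f i) * prod f (A - {i}))"
  using assms
proof (induction A rule: finite_induct)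
  case (insert x A)
  have "prod f (insert x A - {i}) = f x * prod f (A - {i})" if "i \<in> A" for i
  proof -
    have "insert x A - {i} = insert x (A - {i})" using insert.hyps that by auto
    then show ?thesis using insert.hyps by simp
  qed
  then show ?case using insert
    by (simp add: ps_adj_mult sum_distrib_left ac_simps cong: sum.cong)
qed simp

lemma ps_adj_power_sum: "0 < s \<Longrightarrow> ps_adj r (power_sum s) = (if r = s then sf_scale (kk * of_nat r) 1 else 0)"
  using ps_adj_pm[of "{#s#}" r] by (auto simp: symfun.scale_left_distrib)

text \<open>On products of power sums both sides vanish unless \<open>N = add_mset r M\<close>; in
  that case they agree by the recursion for \<open>zm\<close>.\<close>

lemma jack_inner_adj:
  assumes "0 < r"
  shows "jack_inner (power_sum r * f) h = jack_inner f (ps_adj r h)"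
proof (induction f rule: pm_induct)
  case (pm M)
  show ?case
  proof (induction h rule: pm_induct)
    case (pm N)
    have "jack_inner (pm (add_mset r M)) (pm N) = jack_inner (pm M) (ps_adj r (pm N))"
    proof (cases "r \<in># N")
      case True
      then obtain N' where N: "N = add_mset r N'" by (meson multi_member_split)
      then show ?thesis using \<open>0 \<notin># M\<close> \<open>0 \<notin># N\<close>
        by (auto simp: jack_inner_pm ps_adj_pm wt_def zm_add algebra_simps simp del: pm_simps)
    next
      case False
      then show ?thesis using \<open>0 \<notin># M\<close> \<open>0 \<notin># N\<close> assms
        by (auto simp: jack_inner_pm ps_adj_pm not_in_iff simp del: pm_simps)
    qed
    then show ?case by simp
  qed (simp_all add: algebra_simps)
qed (simp_all add: algebra_simps sf_scale_mult)

text \<open>\<open>kk\<close> is an indeterminate. This keeps the denominators and diagonal factors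
  below from vanishing.\<close>

lemma kk_generic: "of_nat a + kk * of_nat b = 0 \<longleftrightarrow> a = 0 \<and> b = 0"
proof -
  have "of_nat a + kk * of_nat b = Fraction_Field.Fract (of_nat a + [:0, 1:] * of_nat b) 1"
    by (simp add: kk_def of_nat_fract)
  also have "\<dots> = 0 \<longleftrightarrow> (of_nat a + [:0, 1:] * of_nat b :: rat poly) = 0"
    by (simp add: Zero_fract_def eq_fract)
  also have "(of_nat a + [:0, 1:] * of_nat b :: rat poly) = [:of_nat a, of_nat b:]"
    by (simp add: of_nat_poly)
  finally show ?thesis by simp
qed

lemma kk_neq_0 [simp]: "kk \<noteq> 0"
  using kk_generic[of 0 1] by simp

section \<open>The dual basis of the monomial functions\<close>

text \<open>The generating function of \<open>gs\<close> is
  \<open>exp (\<Sum>\<^sub>r p\<^sub>r t\<^sup>r / (k r))\<close>; the recursion expresses its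
  logarithmic derivative.\<close>

fun gs :: "nat \<Rightarrow> ratfun symfun" where
  "gs 0 = 1"
| "gs (Suc s) = sf_scale (1 / (kk * of_nat (Suc s))) (\<Sum>t\<le>s. power_sum (Suc s - t) * gs t)"

lemma gs_rec: "sf_scale (kk * of_nat s) (gs s) = (\<Sum>t<s. power_sum (s - t) * gs t)"
  by (cases s) (simp_all del: of_nat_Suc add: lessThan_Suc_atMost)

lemma ps_adj_gs:
  assumes "0 < r"
  shows "ps_adj r (gs s) = (if r \<le> s then gs (s - r) else 0)"
proof (induction s rule: less_induct)
  case (less s)
  show ?case
  proof (cases "s = 0")
    case True
    then show ?thesis using assms by simp
  next
    case False
    have A: "(\<Sum>t<s. ps_adj r (power_sum (s - t)) * gs t) =
        (if r \<le> s then sf_scale (kk * of_nat r) (gs (s - r)) else 0)"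
    proof -
      have "(\<Sum>t<s. ps_adj r (power_sum (s - t)) * gs t) =
          (\<Sum>t<s. if t = s - r \<and> r \<le> s then sf_scale (kk * of_nat r) (gs (s - r)) else 0)"
        by (intro sum.cong) (auto simp: ps_adj_power_sum sf_scale_mult)
      also have "\<dots> = (if r \<le> s then sf_scale (kk * of_nat r) (gs (s - r)) else 0)"
        using False assms by (cases "r \<le> s") auto
      finally show ?thesis .
    qed
    have B: "(\<Sum>t<s. power_sum (s - t) * ps_adj r (gs t)) =
        (if r \<le> s then sf_scale (kk * of_nat (s - r)) (gs (s - r)) else 0)"
    proof (cases "r \<le> s")
      case True
      have "(\<Sum>t<s. power_sum (s - t) * ps_adj r (gs t)) = (\<Sum>t\<in>{r..<s}. power_sum (s - t) * gs (t - r))"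
        by (rule sum.mono_neutral_cong_right) (auto simp: less.IH)
      also have "\<dots> = (\<Sum>t<s - r. power_sum (s - r - t) * gs t)"
        by (rule sum.reindex_bij_witness[where i = "\<lambda>t. t + r" and j = "\<lambda>t. t - r"]) auto
      also have "\<dots> = sf_scale (kk * of_nat (s - r)) (gs (s - r))" by (rule gs_rec[symmetric])
      finally show ?thesis using True by (simp only: if_True)
    next
      case False
      then show ?thesis by (simp add: less.IH)
    qed
    have "sf_scale (kk * of_nat s) (ps_adj r (gs s)) = ps_adj r (\<Sum>t<s. power_sum (s - t) * gs t)"
      by (simp flip: gs_rec)
    also have "\<dots> = (if r \<le> s then sf_scale (kk * of_nat s) (gs (s - r)) else 0)"
      using A B by (auto simp: ps_adj_mult sum.distrib simp flip: symfun.scale_left_distrib distrib_left of_nat_add)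
    also have "\<dots> = sf_scale (kk * of_nat s) (if r \<le> s then gs (s - r) else 0)" by simp
    finally show ?thesis using False by (simp only: symfun.scale_cancel_left) simp
  qed
qed

definition gprod :: "nat \<Rightarrow> (nat \<Rightarrow> nat) \<Rightarrow> ratfun symfun" where
  "gprod n \<kappa> = (\<Prod>i<n. gs (\<kappa> i))"

lemma gprod_upd: "i < n \<Longrightarrow> gprod n (\<kappa>(i := x)) = gs x * (\<Prod>j\<in>{..<n} - {i}. gs (\<kappa> j))"
  by (simp add: gprod_def prod.remove[of _ i])

text \<open>If some index is positive, every term of that \<open>gs\<close> has a power sum as a
  factor, and its adjoint kills 1.\<close>

lemma jack_inner_gprod_1: "jack_inner (gprod n \<kappa>) 1 = (if \<forall>i<n. \<kappa> i = 0 then 1 else 0)"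
proof (cases "\<forall>i<n. \<kappa> i = 0")
  case True
  then have "gprod n \<kappa> = pm {#}" by (simp add: gprod_def)
  then show ?thesis using True jack_inner_pm[of "{#}" "{#}"] by (simp add: wt_def zm_def)
next
  case False
  then obtain i s where i: "i < n" "\<kappa> i = Suc s" by (metis not0_implies_Suc)
  have "gprod n \<kappa> = gs (Suc s) * (\<Prod>j\<in>{..<n} - {i}. gs (\<kappa> j))"
    using gprod_upd[OF i(1), of \<kappa> "Suc s"] fun_upd_idem[of \<kappa> i, OF i(2)] by (simp only:)
  then have "jack_inner (gprod n \<kappa>) 1 = 0"
    by (simp add: sf_scale_mult sum_distrib_right mult.assoc jack_inner_adj)
  then show ?thesis using False by simp
qed

lemma monom_of_eq_empty: "monom_of n \<kappa> = {#} \<longleftrightarrow> (\<forall>i<n. \<kappa> i = 0)"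
  by (metis (no_types, lifting) count_empty count_monom_of multiset_eqI)

lemma replicate_subset_monom_of: "0 < r \<Longrightarrow> replicate_mset r i \<subseteq># monom_of n \<kappa> \<longleftrightarrow> i < n \<and> r \<le> \<kappa> i"
  by (simp add: count_monom_of flip: count_le_replicate_mset_subset_eq)

lemma monom_of_diff_replicate: "i < n \<Longrightarrow> monom_of n \<kappa> - replicate_mset r i = monom_of n (\<kappa>(i := \<kappa> i - r))"
  by (rule multiset_eqI) (auto simp: count_monom_of)

text \<open>This is the duality with the monomial functions. A power sum moved across the form
  lowers one index of the product by \<open>r\<close>; multiplying by it lowers one exponent of the
  monomial in the same way.\<close>

lemma jack_inner_gprod: "jack_inner (gprod n \<kappa>) f = sf_coeff f (monom_of n \<kappa>)"
proof (induction f rule: pm_induct)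
  case (pm M)
  then show ?case
  proof (induction M arbitrary: \<kappa>)
    case empty
    then show ?case by (simp add: jack_inner_gprod_1 monom_of_eq_empty)
  next
    case (add r M)
    then have r: "0 < r" and M: "0 \<notin># M" by auto
    have "jack_inner (gprod n \<kappa>) (pm (add_mset r M)) = jack_inner (ps_adj r (gprod n \<kappa>)) (pm M)"
      using jack_inner_adj[OF r] by (simp add: jack_inner_commute[of _ "pm M"] jack_inner_commute[of "gprod n \<kappa>"])
    also have "ps_adj r (gprod n \<kappa>) = (\<Sum>i<n. if r \<le> \<kappa> i then gprod n (\<kappa>(i := \<kappa> i - r)) else 0)"
      unfolding gprod_def[of n \<kappa>]
      by (simp add: ps_adj_prod ps_adj_gs[OF r], intro sum.cong) (auto simp: gprod_upd)
    also have "\<dots> = (\<Sum>i | i < n \<and> r \<le> \<kappa> i. gprod n (\<kappa>(i := \<kappa> i - r)))"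
      by (rule sum.mono_neutral_cong_right) auto
    also have "jack_inner \<dots> (pm M) = sf_coeff (pm (add_mset r M)) (monom_of n \<kappa>)"
      by (simp add: add.IH[OF M] sf_coeff_power_sum_mult[OF r] replicate_subset_monom_of[OF r] monom_of_diff_replicate fun_upd_def)
    finally show ?case .
  qed
qed simp_all

section \<open>Elementary symmetric functions\<close>

definition elem_sf :: "nat \<Rightarrow> 'a::comm_ring_1 symfun" where
  "elem_sf m = monomial_sf (replicate m 1)"

lemma exponents_sqfree: "exponents \<alpha> = replicate_mset m 1 \<longleftrightarrow> size \<alpha> = m \<and> (\<forall>i. count \<alpha> i \<le> 1)"
proof
  assume *: "exponents \<alpha> = replicate_mset m 1"
  have "count \<alpha> i \<le> 1" for i
  proof (cases "i \<in># \<alpha>")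
    case True
    then have "count \<alpha> i \<in># exponents \<alpha>" by (simp add: exponents_def)
    then show ?thesis by (simp add: * split: if_splits)
  qed (simp add: not_in_iff)
  moreover have "size \<alpha> = m" using sum_mset_exponents[of \<alpha>] by (simp add: *)
  ultimately show "size \<alpha> = m \<and> (\<forall>i. count \<alpha> i \<le> 1)" by simp
next
  assume *: "size \<alpha> = m \<and> (\<forall>i. count \<alpha> i \<le> 1)"
  have "exponents \<alpha> = image_mset (\<lambda>_. 1) (mset_set (set_mset \<alpha>))"
    unfolding exponents_def using * by (intro image_mset_cong) (auto simp: le_Suc_eq simp flip: not_in_iff)
  then have e: "exponents \<alpha> = replicate_mset (card (set_mset \<alpha>)) 1" by (simp add: image_mset_const_eq)
  then show "exponents \<alpha> = replicate_mset m 1" using * sum_mset_exponents[of \<alpha>] by simp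
qed

lemma sf_coeff_elem_sf: "sf_coeff (elem_sf m) \<alpha> = (if size \<alpha> = m \<and> (\<forall>i. count \<alpha> i \<le> 1) then 1 else 0)"
  by (simp only: elem_sf_def sf_coeff_monomial_sf mset_replicate exponents_sqfree)

lemma elem_sf_0 [simp]: "elem_sf 0 = 1"
  by (rule sf_eqI) (auto simp: sf_coeff_elem_sf)

text \<open>If \<open>i\<close> is the only repeated variable, only \<open>r = count \<alpha> i\<close> and \<open>r = count \<alpha> i - 1\<close> contribute,
  with opposite signs.\<close>

lemma alternating_count_sum:
  fixes \<alpha> :: "nat multiset"
  assumes "i \<in># \<alpha>"
  shows "(\<Sum>r=1..count \<alpha> i. if \<forall>j. count (\<alpha> - replicate_mset r i) j \<le> 1 then (- 1) ^ (r - 1) else 0) =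
    (if \<forall>j. count \<alpha> j \<le> 1 then 1 else 0 :: 'a::comm_ring_1)"
proof -
  define Q where "Q \<longleftrightarrow> (\<forall>j. j \<noteq> i \<longrightarrow> count \<alpha> j \<le> 1)"
  have sq: "(\<forall>j. count (\<alpha> - replicate_mset r i) j \<le> 1) \<longleftrightarrow> Q \<and> count \<alpha> i \<le> Suc r" for r
    by (auto simp: Q_def split: if_splits)
  obtain c where c: "count \<alpha> i = Suc c" using assms by (metis Suc_pred count_greater_zero_iff)
  have "(\<forall>j. count \<alpha> j \<le> 1) \<longleftrightarrow> Q \<and> count \<alpha> i \<le> 1" unfolding Q_def by metis
  then have sq0: "(\<forall>j. count \<alpha> j \<le> 1) \<longleftrightarrow> Q \<and> c = 0" by (simp add: c)
  show ?thesis
  proof (cases c)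
    case 0
    then show ?thesis unfolding sq sq0 c by simp
  next
    case (Suc d)
    have "(\<Sum>r=1..Suc c. if Q \<and> Suc c \<le> Suc r then (- 1) ^ (r - 1) else (0 :: 'a)) =
       (\<Sum>r\<in>{c, Suc c}. if Q \<and> Suc c \<le> Suc r then (- 1) ^ (r - 1) else (0 :: 'a))"
      by (rule sum.mono_neutral_right) (auto simp: Suc)
    also have "\<dots> = 0" by (simp add: Suc)
    finally show ?thesis unfolding sq sq0 c by (simp add: Suc)
  qed
qed

text \<open>Coefficients are compared at \<open>\<alpha>\<close>, with \<open>r = m - t\<close> the
  exponent taken from one variable.\<close>

lemma newton:
  "of_nat m * elem_sf m = (\<Sum>t<m. (- 1) ^ (m - t - 1) * (power_sum (m - t) * elem_sf t) :: 'a::comm_ring_1 symfun)"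
proof (rule sf_eqI)
  fix \<alpha>
  let ?sq = "\<lambda>\<beta>::nat multiset. \<forall>j. count \<beta> j \<le> 1"
  have sgn: "sf_coeff ((- 1) ^ a * f) \<beta> = (- 1) ^ a * sf_coeff f \<beta>" for a \<beta> and f :: "'a symfun"
    by (cases "even a") simp_all
  have "sf_coeff (\<Sum>t<m. (- 1) ^ (m - t - 1) * (power_sum (m - t) * elem_sf t)) \<alpha> =
     (\<Sum>t<m. \<Sum>i | replicate_mset (m - t) i \<subseteq># \<alpha>. if size \<alpha> = m \<and> ?sq (\<alpha> - replicate_mset (m - t) i) then (- 1) ^ (m - t - 1) else 0 :: 'a)"
    unfolding sf_coeff_sum sgn
  proof (intro sum.cong refl)
    fix t assume "t \<in> {..<m}"
    then have "0 < m - t" by simp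
    have sz: "size (\<alpha> - replicate_mset (m - t) i) = t \<longleftrightarrow> size \<alpha> = m" if "replicate_mset (m - t) i \<subseteq># \<alpha>" for i
      using that size_mset_mono[OF that] \<open>t \<in> {..<m}\<close> by (auto simp: size_Diff_submset)
    show "(- 1) ^ (m - t - 1) * sf_coeff (power_sum (m - t) * elem_sf t) \<alpha> = (\<Sum>i | replicate_mset (m - t) i \<subseteq># \<alpha>. if size \<alpha> = m \<and> ?sq (\<alpha> - replicate_mset (m - t) i) then (- 1) ^ (m - t - 1) else 0 :: 'a)"
      unfolding sf_coeff_power_sum_mult[OF \<open>0 < m - t\<close>] sum_distrib_left
      by (intro sum.cong refl) (simp add: sf_coeff_elem_sf sz)
  qed
  also have "\<dots> = sf_coeff (of_nat m * elem_sf m) \<alpha>"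
  proof (cases "size \<alpha> = m")
    case False
    then show ?thesis by (simp add: sf_coeff_elem_sf flip: sf_scale_of_int[of "int m", simplified])
  next
    case True
    have cnt: "count \<alpha> i \<le> m" for i using True count_le_size by metis
    define H where "H r = (\<Sum>i\<in>{i \<in> set_mset \<alpha>. r \<le> count \<alpha> i}.
      if ?sq (\<alpha> - replicate_mset r i) then (- 1) ^ (r - 1) else 0 :: 'a)" for r
    have H: "(\<Sum>i | replicate_mset r i \<subseteq># \<alpha>. if size \<alpha> = m \<and> ?sq (\<alpha> - replicate_mset r i)
        then (- 1) ^ (r - 1) else 0 :: 'a) = H r" if "0 < r" for r
    proof -
      have "{i. replicate_mset r i \<subseteq># \<alpha>} = {i \<in> set_mset \<alpha>. r \<le> count \<alpha> i}"
        using that by (auto simp flip: count_le_replicate_mset_subset_eq intro!: count_inI)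
      then show ?thesis using True by (simp add: H_def)
    qed
    have "(\<Sum>t<m. \<Sum>i | replicate_mset (m - t) i \<subseteq># \<alpha>. if size \<alpha> = m \<and> ?sq (\<alpha> - replicate_mset (m - t) i) then (- 1) ^ (m - t - 1) else 0 :: 'a)
      = (\<Sum>t<m. H (m - t))"
      by (intro sum.cong refl H) simp
    also have "\<dots> = (\<Sum>r\<in>{1..m}. H r)"
      by (rule sum.reindex_bij_witness[of _ "\<lambda>r. m - r" "\<lambda>t. m - t"]) auto
    also have "\<dots> = (\<Sum>r\<in>{1..m}. \<Sum>i\<in>{i \<in> set_mset \<alpha>. r \<le> count \<alpha> i}.
      if ?sq (\<alpha> - replicate_mset r i) then (- 1) ^ (r - 1) else 0)"
      by (simp add: H_def)
    \<comment> \<open>Regrouped by variable, the alternating sum of each variable of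
      \<open>\<alpha>\<close> is 1 if \<open>\<alpha>\<close> is squarefree and 0 otherwise.\<close>
    also have "\<dots> = (\<Sum>i\<in>set_mset \<alpha>. \<Sum>r\<in>{r \<in> {1..m}. r \<le> count \<alpha> i}. if ?sq (\<alpha> - replicate_mset r i) then (- 1) ^ (r - 1) else 0)"
      by (rule sum.swap_restrict) auto
    also have "\<dots> = (\<Sum>i\<in>set_mset \<alpha>. if ?sq \<alpha> then 1 else 0)"
    proof (rule sum.cong[OF refl])
      fix i assume i: "i \<in># \<alpha>"
      have "{r \<in> {1..m}. r \<le> count \<alpha> i} = {1..count \<alpha> i}" using cnt[of i] by auto
      then show "(\<Sum>r\<in>{r \<in> {1..m}. r \<le> count \<alpha> i}. if ?sq (\<alpha> - replicate_mset r i) then (- 1) ^ (r - 1) else 0) = (if ?sq \<alpha> then 1 else 0 :: 'a)"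
        using alternating_count_sum[OF i] by simp
    qed
    also have "\<dots> = (if ?sq \<alpha> then of_nat m else 0)"
      using True exponents_sqfree[of \<alpha> m] size_exponents[of \<alpha>] by auto
    also have "\<dots> = sf_coeff (of_nat m * elem_sf m) \<alpha>"
      using True by (simp add: sf_coeff_elem_sf flip: sf_scale_of_int[of "int m", simplified])
    finally show ?thesis .
  qed
  finally show "sf_coeff (of_nat m * elem_sf m) \<alpha> = (
    sf_coeff (\<Sum>t<m. (- 1) ^ (m - t - 1) * (power_sum (m - t) * elem_sf t)) \<alpha> :: 'a)" by (simp only:)
qed

text \<open>The entry in column \<open>m\<close> of a row with shifted part \<open>s\<close>:
  \<open>c = 0\<close> gives the matrices of A, \<open>c = 1\<close> those of B, and
  \<open>gs\<close> at a negative index counts as 0.\<close>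

definition ent :: "nat \<Rightarrow> nat \<Rightarrow> nat \<Rightarrow> ratfun symfun" where
  "ent c m s = (if m \<le> s then sf_scale (of_nat (m + c) + kk * of_nat (s - m)) (gs (s - m)) else 0)"

lemma ent_Suc: "ent 0 (Suc m) (Suc s) = ent 1 m s"
  by (simp add: ent_def)

text \<open>With \<open>E\<close> and \<open>G\<close> the generating functions of the signed
  \<open>elem_sf\<close> and of \<open>gs\<close>, Newton's identities say
  \<open>t E' = - p E\<close> and the recursion says \<open>k t G' = p G\<close>. Hence
  \<open>t E' G + k E t G' = 0\<close>, whose coefficient at \<open>s\<close> is the
  relation.\<close>

lemma elem_sf_ent_relation: "(\<Sum>m\<le>s. (- 1) ^ m * elem_sf m * ent 0 m s) = 0"
proof -
  define E :: "ratfun symfun fps" where "E = Abs_fps (\<lambda>m. (- 1) ^ m * elem_sf m)"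
  define G where "G = Abs_fps gs"
  define p :: "ratfun symfun fps" where "p = Abs_fps (\<lambda>r. if r = 0 then 0 else power_sum r)"
  let ?k = "fps_const (sf_scale kk 1)"
  have nX: "fps_nth (fps_X * fps_deriv F) m = of_nat m * fps_nth F m" for F :: "ratfun symfun fps" and m
    by (cases m) simp_all
  have pF: "fps_nth (p * F) m = (\<Sum>t<m. power_sum (m - t) * fps_nth F t)" for F m
  proof -
    have "fps_nth (p * F) m = (\<Sum>t=0..m. fps_nth F t * fps_nth p (m - t))" by (simp only: mult.commute[of p] fps_mult_nth)
    also have "\<dots> = (\<Sum>t<m. power_sum (m - t) * fps_nth F t)"
      by (rule sum.mono_neutral_cong_right) (auto simp: p_def mult.commute)
    finally show ?thesis .
  qed
  have E: "fps_X * fps_deriv E = - (p * E)"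
  proof (rule fps_ext)
    fix m
    have "(- 1) ^ m * (of_nat m * elem_sf m) = - (\<Sum>t<m. power_sum (m - t) * ((- 1) ^ t * elem_sf t) :: ratfun symfun)"
      unfolding newton sum_distrib_left sum_negf[symmetric]
    proof (rule sum.cong[OF refl])
      fix t assume "t \<in> {..<m}"
      then have m: "m = t + (m - t - 1) + 1" by simp
      define A :: "ratfun symfun" where "A = (- 1) ^ t"
      define B :: "ratfun symfun" where "B = (- 1) ^ (m - t - 1)"
      \<comment> \<open>The signs are named so that \<open>B * B = 1\<close> can be used without a
        parity distinction.\<close>
      have "(- 1) ^ m = A * B * (- 1)"
        unfolding A_def B_def by (subst m) (simp only: power_add power_one_right)
      moreover have "B * B = 1" by (simp add: B_def flip: power_mult_distrib)
      moreover have "A * B * (- 1) * (B * (x * y)) = - ((B * B) * (x * (A * y)))" for x y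
        by (simp add: ac_simps)
      ultimately show "(- 1) ^ m * ((- 1) ^ (m - t - 1) * (power_sum (m - t) * elem_sf t)) =
          - (power_sum (m - t) * ((- 1) ^ t * elem_sf t) :: ratfun symfun)"
        unfolding A_def[symmetric] B_def[symmetric] by (simp only: mult_1_left)
    qed
    then show "fps_nth (fps_X * fps_deriv E) m = fps_nth (- (p * E)) m"
      by (simp add: nX pF, simp add: E_def mult.left_commute)
  qed
  have G: "?k * (fps_X * fps_deriv G) = p * G"
  proof (rule fps_ext)
    fix s
    show "fps_nth (?k * (fps_X * fps_deriv G)) s = fps_nth (p * G) s"
      using gs_rec[of s] unfolding mult.commute[of kk] by (simp only: fps_mult_left_const_nth nX pF)
       (simp add: G_def sf_scale_mult symfun.scale_scale flip: sf_scale_of_int[of "int s", simplified])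
  qed
  have "fps_X * fps_deriv E * G + E * (?k * (fps_X * fps_deriv G)) = 0"
    unfolding E G by (simp add: algebra_simps)
  then have "fps_nth (fps_X * fps_deriv E * G + E * (?k * (fps_X * fps_deriv G))) s = 0" by simp
  then have "(\<Sum>m=0..s. (of_nat m * fps_nth E m) * fps_nth G (s - m)) + (\<Sum>m=0..s. fps_nth E m * (sf_scale kk 1 * (of_nat (s - m) * fps_nth G (s - m)))) = 0"
    by (simp only: fps_add_nth fps_mult_nth[of "_ * _" G] fps_mult_nth[of E] nX fps_mult_left_const_nth)
  also have "(\<Sum>m=0..s. (of_nat m * fps_nth E m) * fps_nth G (s - m)) + (\<Sum>m=0..s. fps_nth E m * (sf_scale kk 1 * (of_nat (s - m) * fps_nth G (s - m)))) =
     (\<Sum>m\<le>s. (- 1) ^ m * elem_sf m * ent 0 m s)"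
    unfolding sum.distrib[symmetric] atMost_atLeast0
    by (intro sum.cong) (simp_all add: ent_def E_def G_def sf_scale_mult symfun.scale_left_distrib symfun.scale_scale[symmetric] algebra_simps
       sf_scale_of_int[of "int _", simplified])
  finally show ?thesis .
qed

section \<open>Restriction to finitely many variables\<close>

text \<open>By symmetry, this says that \<open>f\<close> becomes 0 when only \<open>n\<close>
  variables are kept. Working modulo these functions replaces a separate ring of polynomials in
  \<open>n\<close> variables.\<close>

definition vanishing :: "nat \<Rightarrow> 'a::comm_ring_1 symfun \<Rightarrow> bool" where
  "vanishing n f \<longleftrightarrow> (\<forall>\<alpha>. card (set_mset \<alpha>) \<le> n \<longrightarrow> sf_coeff f \<alpha> = 0)"

lemma vanishing_0 [simp]: "vanishing n 0"
  and vanishing_add: "vanishing n f \<Longrightarrow> vanishing n g \<Longrightarrow> vanishing n (f + g)"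
  and vanishing_uminus: "vanishing n f \<Longrightarrow> vanishing n (- f)"
  by (simp_all add: vanishing_def)

lemma vanishing_mult: "vanishing n f \<Longrightarrow> vanishing n (f * g)"
  unfolding vanishing_def sf_coeff_mult
proof (intro allI impI sum.neutral ballI)
  fix \<alpha> \<beta> :: "nat multiset"
  assume f: "\<forall>\<alpha>. card (set_mset \<alpha>) \<le> n \<longrightarrow> sf_coeff f \<alpha> = 0"
    and \<alpha>: "card (set_mset \<alpha>) \<le> n" and \<beta>: "\<beta> \<in> {\<beta>. \<beta> \<subseteq># \<alpha>}"
  have "card (set_mset \<beta>) \<le> card (set_mset \<alpha>)"
    using \<beta> by (intro card_mono) (auto dest: set_mset_mono)
  with f \<alpha> show "sf_coeff f \<beta> * sf_coeff g (\<alpha> - \<beta>) = 0" by simp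
qed

lemma vanishing_sum: "(\<And>x. x \<in> A \<Longrightarrow> vanishing n (f x)) \<Longrightarrow> vanishing n (sum f A)"
  by (induction A rule: infinite_finite_induct) (simp_all add: vanishing_add)

lemma vanishing_prod_diff:
  "(\<And>x. x \<in> A \<Longrightarrow> vanishing n (f x - g x)) \<Longrightarrow> vanishing n (prod f A - prod g A)"
proof (induction A rule: infinite_finite_induct)
  case (insert x A)
  have "prod f (insert x A) - prod g (insert x A) =
      (f x - g x) * prod f A + (prod f A - prod g A) * g x"
    using insert.hyps by (simp add: algebra_simps)
  then show ?case using insert by (simp add: vanishing_add vanishing_mult)
qed simp_all

text \<open>The functions vanishing in finitely many variables are closed under sums and multiples,
  so congruent entries give congruent determinants.\<close>

lemma vanishing_det_diff:
  assumes A: "A \<in> carrier_mat n n" and B: "B \<in> carrier_mat n n"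
    and AB: "\<And>i j. i < n \<Longrightarrow> j < n \<Longrightarrow> vanishing k (A $$ (i, j) - B $$ (i, j))"
  shows "vanishing k (det A - det B)"
  unfolding det_def'[OF A] det_def'[OF B] sum_subtractf[symmetric] right_diff_distrib[symmetric]
proof (rule vanishing_sum)
  fix w assume "w \<in> {w. w permutes {0..<n}}"
  then have w: "w i < n" if "i < n" for i using that permutes_in_image[of w "{0..<n}" i] by auto
  have "vanishing k ((\<Prod>i = 0..<n. A $$ (i, w i)) - (\<Prod>i = 0..<n. B $$ (i, w i)))"
    by (rule vanishing_prod_diff) (use AB w in simp)
  from vanishing_mult[OF this, of "signof w"]
  show "vanishing k (signof w * ((\<Prod>i = 0..<n. A $$ (i, w i)) - (\<Prod>i = 0..<n. B $$ (i, w i))))"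
    by (simp add: mult.commute)
qed

lemma vanishing_elem_sf: "n < m \<Longrightarrow> vanishing n (elem_sf m)"
  unfolding vanishing_def
proof (intro allI impI)
  fix \<alpha> :: "nat multiset" assume *: "n < m" "card (set_mset \<alpha>) \<le> n"
  show "sf_coeff (elem_sf m) \<alpha> = (0 :: 'a)"
  proof (rule ccontr)
    assume "sf_coeff (elem_sf m) \<alpha> \<noteq> (0 :: 'a)"
    then have "exponents \<alpha> = replicate_mset m 1"
      by (auto simp: elem_sf_def sf_coeff_monomial_sf simp del: One_nat_def split: if_splits)
    then have "card (set_mset \<alpha>) = m" using size_exponents[of \<alpha>] by simp
    with * show False by simp
  qed
qed

section \<open>The determinants\<close>

definition jt_mat :: "nat \<Rightarrow> nat \<Rightarrow> (nat \<Rightarrow> nat) \<Rightarrow> ratfun symfun mat" where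
  "jt_mat c n \<kappa> = mat n n (\<lambda>(i, j). ent c j (\<kappa> i + i))"

definition jt :: "nat \<Rightarrow> nat \<Rightarrow> (nat \<Rightarrow> nat) \<Rightarrow> ratfun symfun" where
  "jt c n \<kappa> = det (jt_mat c n \<kappa>)"

lemma jt_mat_carrier [simp]: "jt_mat c n \<kappa> \<in> carrier_mat n n"
  by (simp add: jt_mat_def)

text \<open>The last row has its only possibly nonzero entry in column 0, and deleting that row and
  column leaves the identity matrix.\<close>

lemma det_companion:
  fixes a :: "nat \<Rightarrow> 'a::comm_ring_1"
  shows "det (mat (Suc p) (Suc p) (\<lambda>(l, j). if j = 0 then - a (Suc l) else if l = j - 1 then 1 else 0)) =
    (- 1) ^ Suc p * a (Suc p)" (is "det ?M = _")
proof -
  have "det ?M = (\<Sum>j<Suc p. ?M $$ (p, j) * cofactor ?M p j)"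
    by (rule laplace_expansion_row) simp_all
  also have "\<dots> = (\<Sum>j<Suc p. if j = 0 then - a (Suc p) * cofactor ?M p 0 else 0)"
    by (intro sum.cong) auto
  also have "\<dots> = - a (Suc p) * cofactor ?M p 0" by simp
  also have "mat_delete ?M p 0 = 1\<^sub>m p"
    by (rule eq_matI) (auto simp: mat_delete_def)
  then have "cofactor ?M p 0 = (- 1) ^ p" by (simp add: cofactor_def)
  finally show ?thesis by simp
qed

text \<open>In \<open>n\<close> variables the matrix of A is the matrix of B times a companion
  matrix of determinant \<open>elem_sf n\<close>: its columns after the first are columns of B by
  \<open>ent_Suc\<close>, and the first is given by the linear relation.\<close>

lemma jt_Suc_vanishing:
  assumes "0 < n"
  shows "vanishing n (jt 0 n (\<lambda>i. \<kappa> i + 1) - elem_sf n * jt 1 n \<kappa>)"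
proof -
  obtain p where n: "n = Suc p" using assms gr0_implies_Suc by blast
  define a :: "nat \<Rightarrow> ratfun symfun" where "a m = (- 1) ^ m * elem_sf m" for m
  define M where "M = mat (Suc p) (Suc p) (\<lambda>(l, j). if j = 0 then - a (Suc l) else if l = j - 1 then 1 else 0)"
  have M: "M \<in> carrier_mat n n" by (simp add: M_def n)
  have "det M = elem_sf n"
    unfolding M_def det_companion by (simp add: a_def n flip: power_mult_distrib mult.assoc)
  then have "elem_sf n * jt 1 n \<kappa> = det (jt_mat 1 n \<kappa> * M)"
    by (simp add: jt_def det_mult[OF jt_mat_carrier M] mult.commute)
  moreover have "vanishing n (det (jt_mat 0 n (\<lambda>i. \<kappa> i + 1)) - det (jt_mat 1 n \<kappa> * M))"
  proof (rule vanishing_det_diff)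
    fix i j assume ij: "i < n" "j < n"
    let ?s = "Suc (\<kappa> i + i)"
    have B: "(jt_mat 1 n \<kappa> * M) $$ (i, j) = (\<Sum>l<n. ent 0 (Suc l) ?s * M $$ (l, j))"
      using ij by (simp add: times_mat_def scalar_prod_def jt_mat_def M_def n ent_Suc atLeast0LessThan del: sum.lessThan_Suc)
    show "vanishing n (jt_mat 0 n (\<lambda>i. \<kappa> i + 1) $$ (i, j) - (jt_mat 1 n \<kappa> * M) $$ (i, j))"
    proof (cases j)
      case (Suc l)
      have "(jt_mat 1 n \<kappa> * M) $$ (i, j) = (\<Sum>l'<n. if l' = l then ent 0 (Suc l) ?s else 0)"
        unfolding B using ij Suc by (intro sum.cong) (auto simp: M_def n)
      also have "\<dots> = ent 0 (Suc l) ?s" using ij Suc by simp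
      finally show ?thesis using ij Suc by (simp add: jt_mat_def)
    next
      case 0
      \<comment> \<open>The relation runs up to \<open>?s\<close>, the matrix product up to
        \<open>n\<close>. Up to the maximum, entries beyond \<open>?s\<close> are 0 and the factors
        \<open>elem_sf m\<close> beyond \<open>n\<close> vanish in \<open>n\<close>
        variables.\<close>
      let ?N = "max n ?s"
      have "(jt_mat 1 n \<kappa> * M) $$ (i, j) = - (\<Sum>l<n. a (Suc l) * ent 0 (Suc l) ?s)"
        unfolding B sum_negf[symmetric] using ij 0 by (intro sum.cong) (auto simp: M_def n)
      then have "jt_mat 0 n (\<lambda>i. \<kappa> i + 1) $$ (i, j) - (jt_mat 1 n \<kappa> * M) $$ (i, j) =
         a 0 * ent 0 0 ?s + (\<Sum>l<n. a (Suc l) * ent 0 (Suc l) ?s)"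
        using ij 0 by (simp add: jt_mat_def a_def)
      also have "\<dots> = (\<Sum>m\<le>n. a m * ent 0 m ?s)"
        by (simp only: sum.lessThan_Suc_shift[of _ n] flip: lessThan_Suc_atMost)
      also have "\<dots> = (\<Sum>m\<le>?N. a m * ent 0 m ?s) - (\<Sum>m\<in>{n<..?N}. a m * ent 0 m ?s)"
      proof -
        have split: "{..?N} = {..n} \<union> {n<..?N}" by auto
        show ?thesis unfolding split by (subst sum.union_disjoint) auto
      qed
      also have "(\<Sum>m\<le>?N. a m * ent 0 m ?s) = (\<Sum>m\<le>?s. a m * ent 0 m ?s)"
        by (rule sum.mono_neutral_right) (auto simp: ent_def)
      also have "\<dots> = 0" unfolding a_def by (rule elem_sf_ent_relation)
      finally have "jt_mat 0 n (\<lambda>i. \<kappa> i + 1) $$ (i, j) - (jt_mat 1 n \<kappa> * M) $$ (i, j) =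
         - (\<Sum>m\<in>{n<..?N}. elem_sf m * ((- 1) ^ m * ent 0 m ?s))"
        by (simp add: a_def ac_simps)
      then show ?thesis
        by (auto intro!: vanishing_uminus vanishing_sum vanishing_mult vanishing_elem_sf)
    qed
  qed (use M in \<open>auto intro!: mult_carrier_mat\<close>)
  ultimately show ?thesis by (simp add: jt_def)
qed

lemma prod_sf_scale:
  fixes c :: "'b \<Rightarrow> 'a::comm_ring_1"
  shows "(\<Prod>i\<in>A. sf_scale (c i) (f i)) = sf_scale (prod c A) (prod f A)"
proof (induction A rule: infinite_finite_induct)
  case (insert x A)
  have "sf_scale (c x) (f x) * sf_scale (prod c A) (prod f A) = sf_scale (c x * prod c A) (f x * prod f A)"
    by (rule sf_eqI) (simp add: sf_scale_mult mult.assoc)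
  with insert show ?case by simp
qed (rule sf_eqI; simp)+

text \<open>Each permutation contributes a multiple of one \<open>gprod\<close>, and duality turns
  its pairing into a coefficient of \<open>f\<close>. An index that would be negative makes the
  whole term 0.\<close>

lemma jack_inner_jt:
  "jack_inner (jt c n \<kappa>) f = (\<Sum>w | w permutes {0..<n}. of_int (sign w) *
     (if \<forall>i<n. w i \<le> \<kappa> i + i
      then (\<Prod>i<n. of_nat (w i + c) + kk * of_nat (\<kappa> i + i - w i)) * sf_coeff f (monom_of n (\<lambda>i. \<kappa> i + i - w i))
      else 0))"
proof -
  have "jt c n \<kappa> = (\<Sum>w | w permutes {0..<n}. sf_scale (of_int (sign w))
     (if \<forall>i<n. w i \<le> \<kappa> i + i
      then sf_scale (\<Prod>i<n. of_nat (w i + c) + kk * of_nat (\<kappa> i + i - w i)) (gprod n (\<lambda>i. \<kappa> i + i - w i))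
      else 0))"
    unfolding jt_def det_def'[OF jt_mat_carrier]
  proof (rule sum.cong[OF refl])
    fix w assume "w \<in> {w. w permutes {0..<n}}"
    then have w: "w i < n" if "i < n" for i using that permutes_in_image[of w "{0..<n}" i] by auto
    have "(\<Prod>i = 0..<n. jt_mat c n \<kappa> $$ (i, w i)) = (\<Prod>i<n. ent c (w i) (\<kappa> i + i))"
      using w by (simp add: jt_mat_def atLeast0LessThan)
    also have "\<dots> = (if \<forall>i<n. w i \<le> \<kappa> i + i
      then sf_scale (\<Prod>i<n. of_nat (w i + c) + kk * of_nat (\<kappa> i + i - w i)) (gprod n (\<lambda>i. \<kappa> i + i - w i))
      else 0)"
    proof (cases "\<forall>i<n. w i \<le> \<kappa> i + i")
      case True
      then show ?thesis by (simp add: ent_def gprod_def flip: prod_sf_scale)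
    next
      case False
      then show ?thesis by (auto simp: ent_def intro!: prod_zero)
    qed
    finally show "signof w * (\<Prod>i = 0..<n. jt_mat c n \<kappa> $$ (i, w i)) = sf_scale (of_int (sign w)) (if \<forall>i<n. w i \<le> \<kappa> i + i
      then sf_scale (\<Prod>i<n. of_nat (w i + c) + kk * of_nat (\<kappa> i + i - w i)) (gprod n (\<lambda>i. \<kappa> i + i - w i))
      else 0)"
      by (simp only: sf_scale_of_int)
  qed
  then show ?thesis
    by (simp add: jack_inner_gprod if_distrib[of "\<lambda>h. jack_inner h f"] cong: if_cong)
qed

section \<open>A statistic that reverses dominance\<close>

text \<open>For a partition this is \<open>\<Sum>\<^sub>i (2 i - 1) \<nu>\<^sub>i\<close>, but its definition makes sense for unsorted exponents.\<close>

definition pair_min :: "nat multiset \<Rightarrow> nat" where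
  "pair_min M = (\<Sum>x\<in>#M. \<Sum>y\<in>#M. min x y)"

lemma pair_min_exponents: "pair_min (exponents (monom_of n \<kappa>)) = (\<Sum>i<n. \<Sum>j<n. min (\<kappa> i) (\<kappa> j))"
proof -
  have *: "(\<Sum>x\<in>#filter_mset (\<lambda>x. x \<noteq> 0) M. f x) = (\<Sum>x\<in>#M. f x)" if "f 0 = 0" for f :: "nat \<Rightarrow> nat" and M
    using that by (induction M) auto
  let ?M = "image_mset \<kappa> (mset_set {..<n})"
  have "pair_min (exponents (monom_of n \<kappa>)) = (\<Sum>x\<in>#?M. \<Sum>y\<in>#filter_mset (\<lambda>x. x \<noteq> 0) ?M. min x y)"
    unfolding pair_min_def exponents_monom_of by (rule *) simp
  also have "\<dots> = (\<Sum>x\<in>#?M. \<Sum>y\<in>#?M. min x y)"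
    by (intro arg_cong[of _ _ sum_mset] image_mset_cong *) simp
  finally show ?thesis by (simp add: multiset.map_comp o_def flip: sum_unfold_sum_mset)
qed

text \<open>Exactly \<open>2 (n - m) - 1\<close> pairs have minimum \<open>m\<close>.\<close>

lemma sum_min_index:
  fixes f :: "nat \<Rightarrow> int"
  shows "(\<Sum>i<n. \<Sum>j<n. f (min i j)) = (\<Sum>i<n. (2 * (int n - int i) - 1) * f i)"
proof (induction n)
  case (Suc n)
  have "(\<Sum>i<n. f (min i n)) = (\<Sum>i<n. f i)" "(\<Sum>i<n. f (min n i)) = (\<Sum>i<n. f i)"
    by (auto intro!: sum.cong simp: min_def)
  then have "(\<Sum>i<Suc n. \<Sum>j<Suc n. f (min i j)) = (\<Sum>i<n. \<Sum>j<n. f (min i j)) + 2 * (\<Sum>i<n. f i) + f n"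
    by (simp add: sum.distrib)
  also have "\<dots> = (\<Sum>i<Suc n. (2 * (int (Suc n) - int i) - 1) * f i)"
    by (simp add: Suc sum_distrib_left algebra_simps flip: sum.distrib)
  finally show ?case .
qed simp

text \<open>The bound is linear in \<open>\<beta>\<close>, unlike the statistic, and is attained for
  weakly increasing \<open>\<beta>\<close>.\<close>

lemma pair_min_exponents_le:
  "pair_min (exponents (monom_of n \<beta>)) \<le> (\<Sum>i<n. \<Sum>j<n. \<beta> (min i j))"
  unfolding pair_min_exponents by (intro sum_mono) (auto simp: min_def)

lemma part_antimono: "is_partition \<nu> \<Longrightarrow> 1 \<le> i \<Longrightarrow> i \<le> j \<Longrightarrow> part \<nu> j \<le> part \<nu> i"
  unfolding part_def is_partition_def
  by (cases "i = j") (auto simp: sorted_wrt_iff_nth_less)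

lemma asc_min:
  assumes "is_partition \<nu>" "i < n" "j < n"
  shows "min (asc n \<nu> i) (asc n \<nu> j) = asc n \<nu> (min i j)"
  using part_antimono[OF assms(1), of "n - j" "n - i"] part_antimono[OF assms(1), of "n - i" "n - j"] assms(2,3)
  by (auto simp: asc_def min_def)

lemma pair_min_asc:
  assumes "is_partition \<nu>" "length \<nu> \<le> n"
  shows "pair_min (mset \<nu>) = (\<Sum>i<n. \<Sum>j<n. asc n \<nu> (min i j))"
  using pair_min_exponents[of n "asc n \<nu>"] exponents_asc[OF assms] asc_min[OF assms(1)]
  by simp

lemma size_monom_of: "size (monom_of n \<kappa>) = (\<Sum>i<n. \<kappa> i)"
  by (induction n) (simp_all add: monom_of_def)

lemma sum_list_asc:
  assumes "is_partition \<nu>" "length \<nu> \<le> n"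
  shows "sum_list \<nu> = (\<Sum>i<n. asc n \<nu> i)"
  using sum_mset_exponents[of "monom_of n (asc n \<nu>)"] exponents_asc[OF assms]
  by (simp add: size_monom_of sum_mset_sum_list)

text \<open>In the expansion of a determinant, a nontrivial permutation \<open>w\<close> lowers the statistic by
  \<open>\<Sum>\<^sub>i (w i - i)\<^sup>2\<close>.\<close>

lemma sum_min_index_permute:
  fixes \<kappa> :: "nat \<Rightarrow> nat"
  assumes w: "w permutes {0..<n}" and le: "\<forall>i<n. w i \<le> \<kappa> i + i"
  shows "int (\<Sum>i<n. \<Sum>j<n. \<kappa> (min i j) + min i j - w (min i j)) =
    int (\<Sum>i<n. \<Sum>j<n. \<kappa> (min i j)) - (\<Sum>i<n. (int (w i) - int i)\<^sup>2)"
proof -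
  have perm: "(\<Sum>i<n. g (w i)) = (\<Sum>i<n. g i)" for g :: "nat \<Rightarrow> int"
    using sum.permute[OF w, of g] by (simp add: atLeast0LessThan o_def)
  have "int (\<Sum>i<n. \<Sum>j<n. \<kappa> (min i j) + min i j - w (min i j)) =
     (\<Sum>i<n. \<Sum>j<n. (\<lambda>m. int (\<kappa> m) + (int m - int (w m))) (min i j))"
    unfolding of_nat_sum by (intro sum.cong refl) (use le in \<open>simp add: of_nat_diff min_def\<close>)
  also have "\<dots> = (\<Sum>i<n. \<Sum>j<n. int (\<kappa> (min i j))) + (\<Sum>i<n. \<Sum>j<n. (\<lambda>m. int m - int (w m)) (min i j))"
    by (simp add: sum.distrib)
  also have "(\<Sum>i<n. \<Sum>j<n. (\<lambda>m. int m - int (w m)) (min i j)) = (\<Sum>i<n. (2 * (int n - int i) - 1) * (int i - int (w i)))"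
    by (rule sum_min_index)
  also have "\<dots> = (2 * int n - 1) * ((\<Sum>i<n. int i) - (\<Sum>i<n. int (w i))) - (\<Sum>i<n. 2 * int i * (int i - int (w i)))"
    unfolding sum_subtractf[symmetric] sum_distrib_left by (intro sum.cong) (auto simp: algebra_simps)
  also have "\<dots> = - (\<Sum>i<n. 2 * int i * (int i - int (w i)))"
    using perm[of int] by simp
  \<comment> \<open>Here \<open>2 i (i - w) = (w - i)\<^sup>2 + i\<^sup>2 - w\<^sup>2\<close>, and
    the last two squares cancel over a permutation.\<close>
  also have "(\<Sum>i<n. 2 * int i * (int i - int (w i))) = (\<Sum>i<n. (int (w i) - int i)\<^sup>2) + ((\<Sum>i<n. (int i)\<^sup>2) - (\<Sum>i<n. (int (w i))\<^sup>2))"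
    unfolding sum_subtractf[symmetric] sum.distrib[symmetric] by (intro sum.cong) (auto simp: algebra_simps power2_eq_square)
  also have "(\<Sum>i<n. (int i)\<^sup>2) - (\<Sum>i<n. (int (w i))\<^sup>2) = 0"
    using perm[of "\<lambda>m. (int m)\<^sup>2"] by simp
  finally show ?thesis by simp
qed

text \<open>The linear bound drops strictly under a nontrivial permutation. It equals the statistic
  for the sorted vector and still dominates it for the possibly unsorted new exponents.\<close>

lemma pair_min_permute_less:
  assumes \<nu>: "is_partition \<nu>" "length \<nu> \<le> n" and w: "w permutes {0..<n}" "w \<noteq> id"
    and le: "\<forall>i<n. w i \<le> asc n \<nu> i + i"
  shows "pair_min (exponents (monom_of n (\<lambda>i. asc n \<nu> i + i - w i))) < pair_min (mset \<nu>)"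
proof -
  obtain i where i: "w i \<noteq> i" using w(2) by (auto simp: fun_eq_iff)
  then have "i < n" using w(1) by (metis atLeastLessThan_iff le0 permutes_not_in)
  then have "0 < (\<Sum>i<n. (int (w i) - int i)\<^sup>2)"
    using i by (intro sum_pos2[of _ i]) auto
  then have "(\<Sum>i<n. \<Sum>j<n. asc n \<nu> (min i j) + min i j - w (min i j)) < (\<Sum>i<n. \<Sum>j<n. asc n \<nu> (min i j))"
    using sum_min_index_permute[OF w(1) le] by linarith
  then show ?thesis
    using pair_min_exponents_le[of n "\<lambda>i. asc n \<nu> i + i - w i"] pair_min_asc[OF \<nu>] by linarith
qed

text \<open>Summation by parts writes the statistic as a decreasing function of the partial sums,
  which are what dominance compares.\<close>

lemma pair_min_partial_sums:
  assumes "is_partition \<nu>" "length \<nu> \<le> n"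
  shows "int (pair_min (mset \<nu>)) = 2 * (\<Sum>r<n. int (sum_list \<nu>) - (\<Sum>i=1..r. int (part \<nu> i))) - int (sum_list \<nu>)"
proof -
  have re: "(\<Sum>i<n. g (n - i) (asc n \<nu> i)) = (\<Sum>i=1..n. g i (part \<nu> i))" for g :: "nat \<Rightarrow> nat \<Rightarrow> int"
    by (rule sum.reindex_bij_witness[of _ "\<lambda>i. n - i" "\<lambda>i. n - i"]) (auto simp: asc_def)
  have tot: "int (sum_list \<nu>) = (\<Sum>i=1..n. int (part \<nu> i))"
    using sum_list_asc[OF assms] re[of "\<lambda>_. int"] by simp
  have *: "(\<Sum>r<m. (\<Sum>i=1..m. f i) - (\<Sum>i=1..r. f i)) = (\<Sum>i=1..m. int i * f i)" for f :: "nat \<Rightarrow> int" and m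
  proof (induction m)
    case (Suc m)
    have "(\<Sum>r<Suc m. (\<Sum>i=1..Suc m. f i) - (\<Sum>i=1..r. f i)) =
       (\<Sum>r<m. ((\<Sum>i=1..m. f i) - (\<Sum>i=1..r. f i)) + f (Suc m)) + f (Suc m)" by (simp add: algebra_simps)
    also have "\<dots> = (\<Sum>i=1..Suc m. int i * f i)" using Suc by (simp add: sum.distrib sum_subtractf algebra_simps)
    finally show ?case .
  qed simp
  have "int (pair_min (mset \<nu>)) = (\<Sum>i<n. (2 * int (n - i) - 1) * int (asc n \<nu> i))"
    using sum_min_index[of "\<lambda>i. int (asc n \<nu> i)" n] pair_min_asc[OF assms] by (simp add: of_nat_diff)
  also have "\<dots> = (\<Sum>i=1..n. (2 * int i - 1) * int (part \<nu> i))" by (rule re)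
  also have "\<dots> = 2 * (\<Sum>i=1..n. int i * int (part \<nu> i)) - (\<Sum>i=1..n. int (part \<nu> i))"
    by (simp add: sum_distrib_left algebra_simps sum_subtractf)
  finally show ?thesis unfolding tot *[symmetric] .
qed

lemma partition_eqI:
  assumes "is_partition \<mu>" "is_partition \<nu>" "\<And>i. part \<mu> (Suc i) = part \<nu> (Suc i)"
  shows "\<mu> = \<nu>"
proof -
  let ?n = "max (length \<mu>) (length \<nu>)"
  have "asc ?n \<mu> i = asc ?n \<nu> i" if "i < ?n" for i
    using assms(3)[of "?n - i - 1"] that by (simp add: asc_def Suc_diff_Suc del: diff_Suc_eq_diff_pred)
  then have "monom_of ?n (asc ?n \<mu>) = monom_of ?n (asc ?n \<nu>)" by (rule monom_of_cong)
  then have "mset \<mu> = mset \<nu>"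
    using exponents_asc[of \<mu> ?n] exponents_asc[of \<nu> ?n] assms(1,2) by simp
  then show ?thesis using is_partition_mset_eq assms(1,2) by blast
qed

text \<open>All partial sums of \<open>\<mu>\<close> are at most those of \<open>\<nu>\<close>.
  Equality for every \<open>r < n\<close>, together with equal weights, would force equal parts, so
  some inequality is strict.\<close>

lemma pair_min_dominated:
  assumes "is_partition \<mu>" "is_partition \<nu>" "dominated \<mu> \<nu>" "\<mu> \<noteq> \<nu>"
  shows "pair_min (mset \<nu>) < pair_min (mset \<mu>)"
proof -
  define n where "n = max (length \<mu>) (length \<nu>)"
  let ?s = "\<lambda>\<nu> r. \<Sum>i=1..r. int (part \<nu> i)"
  have le: "?s \<mu> r \<le> ?s \<nu> r" for r
    using assms(3) by (simp add: dominated_def flip: of_nat_sum)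
  have "\<exists>r<n. ?s \<mu> r \<noteq> ?s \<nu> r"
  proof (rule ccontr)
    assume "\<not> ?thesis"
    then have eq: "?s \<mu> r = ?s \<nu> r" if "r < n" for r using that by blast
    have tot: "?s \<nu>' n = int (sum_list \<nu>')" if "is_partition \<nu>'" "length \<nu>' \<le> n" for \<nu>'
      unfolding sum_list_asc[OF that] of_nat_sum
      by (rule sum.reindex_bij_witness[of _ "\<lambda>i. n - i" "\<lambda>i. n - i"]) (auto simp: asc_def)
    have "?s \<mu> n = ?s \<nu> n" using tot[of \<mu>] tot[of \<nu>] assms by (simp add: n_def dominated_def)
    with eq have eq': "?s \<mu> r = ?s \<nu> r" if "r \<le> n" for r using that by (cases "r = n") auto
    have "part \<mu> (Suc i) = part \<nu> (Suc i)" for i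
    proof (cases "Suc i \<le> n")
      case True
      then show ?thesis using eq'[of i] eq'[of "Suc i"] by simp
    next
      case False
      then show ?thesis by (auto simp: part_def n_def)
    qed
    with assms show False using partition_eqI by blast
  qed
  then obtain r where r: "r < n" "?s \<mu> r < ?s \<nu> r" using le by (metis order.not_eq_order_implies_strict)
  have "(\<Sum>r<n. int (sum_list \<nu>) - ?s \<nu> r) < (\<Sum>r<n. int (sum_list \<mu>) - ?s \<mu> r)"
    using r le assms(3) by (intro sum_strict_mono_ex1) (auto simp: dominated_def intro!: bexI[of _ r])
  moreover have "length \<mu> \<le> n" "length \<nu> \<le> n" by (simp_all add: n_def)
  ultimately show ?thesis
    using pair_min_partial_sums[OF assms(1), of n] pair_min_partial_sums[OF assms(2), of n] assms(3)
    by (simp add: dominated_def)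
qed

text \<open>If \<open>\<mu>\<close> were shorter, its \<open>length \<mu>\<close> parts would
  already sum to the full weight, while \<open>\<nu>\<close> still has a positive part to
  come.\<close>

lemma length_dominated:
  assumes "is_partition \<mu>" "is_partition \<nu>" "dominated \<mu> \<nu>"
  shows "length \<nu> \<le> length \<mu>"
proof (rule ccontr)
  assume "\<not> ?thesis"
  then have l: "length \<mu> < length \<nu>" by simp
  let ?m = "length \<mu>" and ?n = "length \<nu>"
  have tot: "(\<Sum>i=1..length \<nu>'. part \<nu>' i) = sum_list \<nu>'" if "is_partition \<nu>'" for \<nu>'
    unfolding sum_list_asc[OF that order_refl]
    by (rule sum.reindex_bij_witness[of _ "\<lambda>i. length \<nu>' - i" "\<lambda>i. length \<nu>' - i"]) (auto simp: asc_def)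
  have "0 < part \<nu> (Suc ?m)" using l assms(2) by (auto simp: part_def is_partition_def in_set_conv_nth intro!: gr0I)
  moreover have "(\<Sum>i=1..?m. part \<nu> i) + part \<nu> (Suc ?m) \<le> (\<Sum>i=1..?n. part \<nu> i)"
    using sum_mono2[of "{1..?n}" "{1..Suc ?m}" "part \<nu>"] l by simp
  moreover have "(\<Sum>i=1..?m. part \<mu> i) \<le> (\<Sum>i=1..?m. part \<nu> i)" using assms(3) by (simp add: dominated_def)
  ultimately show False using tot[OF assms(1)] tot[OF assms(2)] assms(3) by (simp add: dominated_def)
qed

section \<open>Adding a first column\<close>

definition up :: "nat \<Rightarrow> nat list \<Rightarrow> nat list" where
  "up n \<nu> = map (\<lambda>i. part \<nu> (Suc i) + 1) [0..<n]"

lemma length_up [simp]: "length (up n \<nu>) = n"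
  by (simp add: up_def)

lemma part_up: "part (up n \<nu>) i = (if 1 \<le> i \<and> i \<le> n then part \<nu> i + 1 else 0)"
  unfolding part_def[of "up n \<nu>"] by (auto simp: up_def)

lemma is_partition_up:
  assumes "is_partition \<nu>"
  shows "is_partition (up n \<nu>)"
  unfolding is_partition_def sorted_wrt_iff_nth_less
  using assms by (auto simp: up_def intro!: part_antimono)

lemma asc_up: "i < n \<Longrightarrow> asc n (up n \<nu>) i = asc n \<nu> i + 1"
  by (simp add: asc_def part_up)

text \<open>Each of the \<open>n * n\<close> minima grows by 1.\<close>

lemma pair_min_up:
  assumes "is_partition \<nu>" "length \<nu> \<le> n"
  shows "pair_min (mset (up n \<nu>)) = pair_min (mset \<nu>) + n * n"
  using pair_min_asc[OF assms] pair_min_asc[OF is_partition_up[OF assms(1)], of n n]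
  by (simp add: asc_up min_def sum.distrib sum_Suc cong: if_cong)

lemma pair_min_exponents_pred:
  assumes "\<forall>i<n. 0 < \<kappa> i"
  shows "pair_min (exponents (monom_of n \<kappa>)) = pair_min (exponents (monom_of n (\<lambda>i. \<kappa> i - 1))) + n * n"
proof -
  have "(\<Sum>i<n. \<Sum>j<n. min (\<kappa> i) (\<kappa> j)) = (\<Sum>i<n. \<Sum>j<n. min (\<kappa> i - 1) (\<kappa> j - 1) + 1)"
    using assms by (intro sum.cong refl) (auto simp: min_def Suc_le_eq)
  then show ?thesis by (simp add: pair_min_exponents sum.distrib sum_Suc)
qed

lemma card_set_monom_of: "card (set_mset (monom_of n \<kappa>)) \<le> n"
  using card_mono[of "{..<n}" "set_mset (monom_of n \<kappa>)"] by (auto simp: set_mset_monom_of)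

text \<open>The only squarefree monomial of degree \<open>n\<close> in the first \<open>n\<close>
  variables is their product, so one term of the convolution survives.\<close>

lemma sf_coeff_elem_sf_mult:
  fixes f :: "'a::comm_ring_1 symfun"
  shows "sf_coeff (elem_sf n * f) (monom_of n \<kappa>) =
    (if \<forall>i<n. 0 < \<kappa> i then sf_coeff f (monom_of n (\<lambda>i. \<kappa> i - 1)) else 0)"
proof -
  let ?o = "monom_of n (\<lambda>_. 1)"
  have o: "\<beta> = ?o" if "\<beta> \<subseteq># monom_of n \<kappa>" "sf_coeff (elem_sf n) \<beta> \<noteq> (0 :: 'a)" for \<beta>
  proof -
    have sq: "size \<beta> = n" "\<forall>i. count \<beta> i \<le> 1" using that(2) by (auto simp: sf_coeff_elem_sf split: if_splits)
    have "set_mset \<beta> \<subseteq> {..<n}" using that(1) by (auto dest!: set_mset_mono simp: set_mset_monom_of)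
    moreover have "card (set_mset \<beta>) = n"
      using sq exponents_sqfree[of \<beta> n] size_exponents[of \<beta>] by (metis size_replicate_mset)
    ultimately have "set_mset \<beta> = {..<n}" by (intro card_subset_eq) auto
    then have mem: "i \<in># \<beta> \<longleftrightarrow> i < n" for i by (simp add: set_eq_iff)
    have "count \<beta> i = (if i < n then 1 else 0)" for i
    proof (cases "i < n")
      case True
      then have "0 < count \<beta> i" by (simp add: mem)
      with sq(2) True show ?thesis by (simp add: order_antisym Suc_le_eq)
    next
      case False
      then show ?thesis using mem[of i] by (simp add: not_in_iff)
    qed
    then show ?thesis by (intro multiset_eqI) (simp add: count_monom_of)
  qed
  have eo: "sf_coeff (elem_sf n) ?o = (1 :: 'a)" by (simp add: sf_coeff_elem_sf size_monom_of count_monom_of)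
  have sub: "?o \<subseteq># monom_of n \<kappa> \<longleftrightarrow> (\<forall>i<n. 0 < \<kappa> i)"
    by (auto simp: subseteq_mset_def count_monom_of Suc_le_eq)
  have diff: "monom_of n \<kappa> - ?o = monom_of n (\<lambda>i. \<kappa> i - 1)"
    by (rule multiset_eqI) (simp add: count_monom_of)
  have "sf_coeff (elem_sf n * f) (monom_of n \<kappa>) =
     (\<Sum>\<beta> | \<beta> \<subseteq># monom_of n \<kappa>. if \<beta> = ?o then sf_coeff f (monom_of n (\<lambda>i. \<kappa> i - 1)) else 0)"
    unfolding sf_coeff_mult
  proof (rule sum.cong[OF refl])
    fix \<beta> assume "\<beta> \<in> {\<beta>. \<beta> \<subseteq># monom_of n \<kappa>}"
    then have "\<beta> \<noteq> ?o \<Longrightarrow> sf_coeff (elem_sf n) \<beta> = (0 :: 'a)" using o[of \<beta>] by blast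
    then show "sf_coeff (elem_sf n) \<beta> * sf_coeff f (monom_of n \<kappa> - \<beta>) =
        (if \<beta> = ?o then sf_coeff f (monom_of n (\<lambda>i. \<kappa> i - 1)) else 0)"
      unfolding diff[symmetric] by (cases "\<beta> = ?o") (simp_all add: eo del: One_nat_def)
  qed
  then show ?thesis by (simp add: finite_subset_mset sub[unfolded One_nat_def])
qed

text \<open>Pairing with \<open>gprod n\<close> reads off the coefficient of a monomial in
  \<open>n\<close> variables. This lets identities valid only in \<open>n\<close> variables be used
  inside the form.\<close>

lemma jack_inner_vanishing:
  assumes "vanishing n f" "h \<in> symfun.span (range (gprod n))"
  shows "jack_inner f h = 0"
  using assms(2)
proof (induction h rule: symfun.span_induct_alt)
  case (step c x y)
  then obtain \<kappa> where "x = gprod n \<kappa>" by blast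
  then have "jack_inner f x = sf_coeff f (monom_of n \<kappa>)"
    by (simp add: jack_inner_commute[of f] jack_inner_gprod)
  then show ?case using step assms(1) card_set_monom_of[of n \<kappa>] by (simp add: vanishing_def)
qed simp

lemma jt_cong: "(\<And>i. i < n \<Longrightarrow> \<kappa> i = \<kappa>' i) \<Longrightarrow> jt c n \<kappa> = jt c n \<kappa>'"
  unfolding jt_def jt_mat_def by (intro arg_cong[of _ _ det] eq_matI) auto

lemma monom_of_permute_less:
  assumes "is_partition \<nu>" "length \<nu> \<le> n" "w permutes {0..<n}" "\<forall>i<n. w i \<le> asc n \<nu> i + i"
  shows "exponents (monom_of n (\<lambda>i. asc n \<nu> i + i - w i)) = mset \<nu> \<and> w = id \<or>
    pair_min (exponents (monom_of n (\<lambda>i. asc n \<nu> i + i - w i))) < pair_min (mset \<nu>) \<and> w \<noteq> id"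
proof (cases "w = id")
  case True
  then show ?thesis using exponents_asc[OF assms(1,2)] by simp
qed (use pair_min_permute_less assms in blast)

section \<open>Jack symmetric functions\<close>

lemma dominated_refl: "dominated \<nu> \<nu>"
  by (simp add: dominated_def)

locale jack =
  fixes P :: "nat list \<Rightarrow> ratfun symfun"
  assumes is_jack: "is_jack P"
begin

lemma P_orth: "is_partition \<nu> \<Longrightarrow> is_partition \<mu> \<Longrightarrow> \<nu> \<noteq> \<mu> \<Longrightarrow> jack_inner (P \<nu>) (P \<mu>) = 0"
  using is_jack by (simp add: is_jack_def)

lemma P_expand:
  assumes "is_partition \<nu>"
  obtains u where "P \<nu> = monomial_sf \<nu> +
    (\<Sum>\<mu> | is_partition \<mu> \<and> dominated \<mu> \<nu> \<and> \<mu> \<noteq> \<nu>. sf_scale (u \<mu>) (monomial_sf \<mu>))"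
  using is_jack assms unfolding is_jack_def by blast

lemma P_coeff_self:
  assumes "is_partition \<nu>" "exponents \<alpha> = mset \<nu>"
  shows "sf_coeff (P \<nu>) \<alpha> = 1"
proof -
  obtain u where u: "P \<nu> = monomial_sf \<nu> +
    (\<Sum>\<mu> | is_partition \<mu> \<and> dominated \<mu> \<nu> \<and> \<mu> \<noteq> \<nu>. sf_scale (u \<mu>) (monomial_sf \<mu>))"
    using P_expand[OF assms(1)] .
  show ?thesis
    unfolding u using assms is_partition_mset_eq[OF assms(1)]
    by (auto simp: sf_coeff_monomial_sf intro!: sum.neutral)
qed

lemma P_support:
  assumes "is_partition \<nu>" "sf_coeff (P \<nu>) \<alpha> \<noteq> 0"
  shows "\<exists>\<mu>. is_partition \<mu> \<and> dominated \<mu> \<nu> \<and> exponents \<alpha> = mset \<mu>"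
proof (rule ccontr)
  assume *: "\<not> ?thesis"
  obtain u where u: "P \<nu> = monomial_sf \<nu> +
    (\<Sum>\<mu> | is_partition \<mu> \<and> dominated \<mu> \<nu> \<and> \<mu> \<noteq> \<nu>. sf_scale (u \<mu>) (monomial_sf \<mu>))"
    using P_expand[OF assms(1)] .
  have "sf_coeff (P \<nu>) \<alpha> = 0"
    unfolding u using * assms(1) dominated_refl
    by (auto simp: sf_coeff_monomial_sf intro!: sum.neutral)
  with assms(2) show False by simp
qed

text \<open>The dominance condition is replaced by a numerical one on which induction is
  possible.\<close>

lemma P_coeff_nonzero:
  assumes "is_partition \<nu>" "sf_coeff (P \<nu>) \<alpha> \<noteq> 0"
  shows "exponents \<alpha> = mset \<nu> \<or> pair_min (mset \<nu>) < pair_min (exponents \<alpha>)"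
  using P_support[OF assms] pair_min_dominated[OF _ assms(1)] by metis

text \<open>Dominated partitions have at least as many parts, so every monomial of
  \<open>P \<nu>\<close> involves at least \<open>length \<nu>\<close> variables.\<close>

lemma P_vanishing:
  assumes "is_partition \<nu>" "n < length \<nu>"
  shows "vanishing n (P \<nu>)"
  unfolding vanishing_def
proof (intro allI impI, rule ccontr)
  fix \<alpha> assume "card (set_mset \<alpha>) \<le> n" "sf_coeff (P \<nu>) \<alpha> \<noteq> 0"
  with P_support[OF assms(1)] obtain \<mu> where
    "is_partition \<mu>" "dominated \<mu> \<nu>" "exponents \<alpha> = mset \<mu>" by blast
  with length_dominated[of \<mu> \<nu>] size_exponents[of \<alpha>] assms \<open>card (set_mset \<alpha>) \<le> n\<close>
  show False by simp
qed

section \<open>The Jack functions as an orthogonal basis\<close>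

text \<open>Among counterexamples of the given weight take one with maximal \<open>pair_min\<close>;
  the other terms of its Jack function have larger \<open>pair_min\<close> and lie in the
  span.\<close>

lemma monomial_sf_in_span_P:
  assumes "is_partition \<nu>"
  shows "monomial_sf \<nu> \<in> symfun.span (P ` Collect is_partition)"
proof -
  define X where "X = {\<mu>. is_partition \<mu> \<and> sum_list \<mu> = sum_list \<nu> \<and> monomial_sf \<mu> \<notin> symfun.span (P ` Collect is_partition)}"
  have fin: "finite X"
    by (rule finite_subset[OF _ finite_partitions[of "sum_list \<nu>"]]) (auto simp: X_def)
  have "X = {}"
  proof (rule ccontr)
    let ?p = "\<lambda>\<mu>. pair_min (mset \<mu>)"
    assume "X \<noteq> {}"
    then have "Max (?p ` X) \<in> ?p ` X" using fin by simp
    then obtain \<mu> where \<mu>: "\<mu> \<in> X" "Max (?p ` X) = ?p \<mu>" by (elim imageE)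
    then have part: "is_partition \<mu>" by (simp add: X_def)
    obtain u where u: "P \<mu> = monomial_sf \<mu> +
      (\<Sum>\<rho> | is_partition \<rho> \<and> dominated \<rho> \<mu> \<and> \<rho> \<noteq> \<mu>. sf_scale (u \<rho>) (monomial_sf \<rho>))"
      using P_expand[OF part] .
    have "monomial_sf \<rho> \<in> symfun.span (P ` Collect is_partition)"
      if \<rho>: "\<rho> \<in> {\<rho>. is_partition \<rho> \<and> dominated \<rho> \<mu> \<and> \<rho> \<noteq> \<mu>}" for \<rho>
    proof (rule ccontr)
      assume "\<not> ?thesis"
      then have "\<rho> \<in> X" using \<rho> \<mu>(1) by (auto simp: X_def dominated_def)
      then have "?p \<rho> \<le> ?p \<mu>" unfolding \<mu>(2)[symmetric] using fin by (intro Max_ge) auto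
      with pair_min_dominated[of \<rho> \<mu>] \<rho> part show False by auto
    qed
    then have "P \<mu> - (\<Sum>\<rho> | is_partition \<rho> \<and> dominated \<rho> \<mu> \<and> \<rho> \<noteq> \<mu>. sf_scale (u \<rho>) (monomial_sf \<rho>))
        \<in> symfun.span (P ` Collect is_partition)"
      using part by (intro symfun.span_diff symfun.span_sum symfun.span_scale) (auto intro: symfun.span_base)
    then have "monomial_sf \<mu> \<in> symfun.span (P ` Collect is_partition)" by (simp add: u)
    with \<mu>(1) show False by (simp add: X_def)
  qed
  then show ?thesis using assms by (auto simp: X_def)
qed

lemma span_P:
  obtains T t where "finite T" "T \<subseteq> Collect is_partition" "f = (\<Sum>\<rho>\<in>T. sf_scale (t \<rho>) (P \<rho>))"
proof -
  obtain S where S: "\<forall>\<nu>\<in>S. is_partition \<nu> \<and> m_coeff f \<nu> \<noteq> 0"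
    "f = (\<Sum>\<nu>\<in>S. sf_scale (m_coeff f \<nu>) (monomial_sf \<nu>))"
    using monomial_expansion[of f] by blast
  have "f \<in> symfun.span (P ` Collect is_partition)"
    by (subst S(2)) (use S(1) in \<open>auto intro!: symfun.span_sum symfun.span_scale monomial_sf_in_span_P\<close>)
  then obtain t r where t: "finite t" "t \<subseteq> P ` Collect is_partition" "f = (\<Sum>a\<in>t. sf_scale (r a) a)"
    unfolding symfun.span_explicit by blast
  obtain T where T: "T \<subseteq> Collect is_partition" "inj_on P T" "t = P ` T"
    using t(2) unfolding subset_image_inj by blast
  show thesis
  proof (rule that[of T "\<lambda>\<rho>. r (P \<rho>)"])
    show "finite T" using t(1) T(2,3) by (simp add: finite_image_iff)
    show "f = (\<Sum>\<rho>\<in>T. sf_scale (r (P \<rho>)) (P \<rho>))"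
      using t(3) by (simp add: T(3) sum.reindex[OF T(2)])
  qed (rule T(1))
qed

abbreviation N :: "nat list \<Rightarrow> ratfun" where
  "N \<nu> \<equiv> jack_inner (P \<nu>) (P \<nu>)"

lemma jack_inner_sum_P:
  assumes "finite T" "T \<subseteq> Collect is_partition" "is_partition \<rho>"
  shows "jack_inner (\<Sum>\<mu>\<in>T. sf_scale (t \<mu>) (P \<mu>)) (P \<rho>) = (if \<rho> \<in> T then t \<rho> * N \<rho> else 0)"
proof -
  have "jack_inner (\<Sum>\<mu>\<in>T. sf_scale (t \<mu>) (P \<mu>)) (P \<rho>) = (\<Sum>\<mu>\<in>T. if \<mu> = \<rho> then t \<rho> * N \<rho> else 0)"
    unfolding jack_inner_sum using assms by (intro sum.cong) (auto simp: P_orth)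
  then show ?thesis using assms(1) by simp
qed

lemma jack_inner_gprod_P:
  assumes "is_partition \<nu>" "length \<nu> \<le> n"
  shows "jack_inner (gprod n (asc n \<nu>)) (P \<nu>) = 1"
  using assms by (simp add: jack_inner_gprod P_coeff_self exponents_asc)

text \<open>Expanding \<open>?g\<close> in the Jack functions, its pairing with
  \<open>P \<nu>\<close> is a multiple of \<open>N \<nu>\<close>, but by duality it is 1.\<close>

lemma N_nonzero:
  assumes "is_partition \<nu>"
  shows "N \<nu> \<noteq> 0"
proof -
  let ?g = "gprod (length \<nu>) (asc (length \<nu>) \<nu>)"
  obtain T t where "finite T" "T \<subseteq> Collect is_partition" "?g = (\<Sum>\<rho>\<in>T. sf_scale (t \<rho>) (P \<rho>))"
    using span_P .
  with jack_inner_sum_P[of T \<nu> t] jack_inner_gprod_P[OF assms order_refl] assms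
  show ?thesis by (auto split: if_splits)
qed

lemma P_expansion:
  "\<exists>T. finite T \<and> (\<forall>\<rho>. \<rho> \<in> T \<longleftrightarrow> is_partition \<rho> \<and> jack_inner f (P \<rho>) \<noteq> 0) \<and>
    f = (\<Sum>\<rho>\<in>T. sf_scale (jack_inner f (P \<rho>) / N \<rho>) (P \<rho>))"
proof -
  obtain T t where T: "finite T" "T \<subseteq> Collect is_partition" "f = (\<Sum>\<rho>\<in>T. sf_scale (t \<rho>) (P \<rho>))"
    using span_P .
  have in_f: "jack_inner f (P \<rho>) = (if \<rho> \<in> T then t \<rho> * N \<rho> else 0)" if "is_partition \<rho>" for \<rho>
    unfolding T(3) using T(1,2) that by (rule jack_inner_sum_P)
  define U where "U = {\<rho> \<in> T. t \<rho> \<noteq> 0}"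
  have "finite U" using T(1) by (simp add: U_def)
  moreover have "\<rho> \<in> U \<longleftrightarrow> is_partition \<rho> \<and> jack_inner f (P \<rho>) \<noteq> 0" for \<rho>
    using in_f[of \<rho>] N_nonzero[of \<rho>] T(2) by (auto simp: U_def split: if_splits)
  moreover have "f = (\<Sum>\<rho>\<in>U. sf_scale (jack_inner f (P \<rho>) / N \<rho>) (P \<rho>))"
  proof -
    have "f = (\<Sum>\<rho>\<in>U. sf_scale (t \<rho>) (P \<rho>))"
      unfolding T(3) U_def using T(1) by (intro sum.mono_neutral_right) auto
    also have "\<dots> = (\<Sum>\<rho>\<in>U. sf_scale (jack_inner f (P \<rho>) / N \<rho>) (P \<rho>))"
      using T(2) in_f N_nonzero by (intro sum.cong) (auto simp: U_def)
    finally show ?thesis .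
  qed
  ultimately show ?thesis by (intro exI[of _ U]) blast
qed

section \<open>Triangularity of Jack functions and determinants\<close>

definition below :: "nat \<Rightarrow> nat \<Rightarrow> ratfun symfun set" where
  "below n s = {gprod n (asc n \<sigma>) |\<sigma>. is_partition \<sigma> \<and> length \<sigma> \<le> n \<and> pair_min (mset \<sigma>) < s}"

text \<open>By duality \<open>?g\<close> is \<open>P \<nu>\<close> divided by \<open>N \<nu>\<close>
  plus multiples of Jack functions with smaller \<open>pair_min\<close>; induction inverts this
  triangular system.\<close>

lemma P_gprod_triangular:
  assumes "is_partition \<nu>" "length \<nu> \<le> n"
  shows "P \<nu> - sf_scale (N \<nu>) (gprod n (asc n \<nu>)) \<in> symfun.span (below n (pair_min (mset \<nu>)))"
  using assms
proof (induction "pair_min (mset \<nu>)" arbitrary: \<nu> rule: less_induct)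
  case less
  let ?g = "gprod n (asc n \<nu>)" and ?B = "symfun.span (below n (pair_min (mset \<nu>)))"
  obtain T where T: "finite T" "\<And>\<rho>. \<rho> \<in> T \<longleftrightarrow> is_partition \<rho> \<and> jack_inner ?g (P \<rho>) \<noteq> 0"
    "?g = (\<Sum>\<rho>\<in>T. sf_scale (jack_inner ?g (P \<rho>) / N \<rho>) (P \<rho>))"
    using P_expansion[of ?g] by blast
  define R where "R = (\<Sum>\<rho>\<in>T - {\<nu>}. sf_scale (jack_inner ?g (P \<rho>) / N \<rho>) (P \<rho>))"
  have g1: "jack_inner ?g (P \<nu>) = 1" using less.prems by (rule jack_inner_gprod_P)
  then have "\<nu> \<in> T" using T(2) less.prems by simp
  then have "?g = sf_scale (1 / N \<nu>) (P \<nu>) + R"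
    unfolding R_def using T(3) sum.remove[OF T(1), of \<nu> "\<lambda>\<rho>. sf_scale (jack_inner ?g (P \<rho>) / N \<rho>) (P \<rho>)"] g1 by simp
  then have "P \<nu> - sf_scale (N \<nu>) ?g = sf_scale (- N \<nu>) R"
    using N_nonzero[OF less.prems(1)] by (simp add: symfun.scale_right_distrib)
  moreover have "P \<rho> \<in> ?B" if \<rho>: "\<rho> \<in> T - {\<nu>}" for \<rho>
  proof -
    have part: "is_partition \<rho>" and nz: "sf_coeff (P \<rho>) (monom_of n (asc n \<nu>)) \<noteq> 0"
      using \<rho> T(2) by (auto simp: jack_inner_gprod)
    have len: "length \<rho> \<le> n"
      using P_vanishing[OF part, of n] nz card_set_monom_of by (force simp: vanishing_def)
    have less': "pair_min (mset \<rho>) < pair_min (mset \<nu>)"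
      using P_coeff_nonzero[OF part nz] \<rho> is_partition_mset_eq[OF less.prems(1) part]
      by (auto simp: exponents_asc[OF less.prems])
    then have "below n (pair_min (mset \<rho>)) \<subseteq> below n (pair_min (mset \<nu>))" by (auto simp: below_def)
    with less.hyps[OF less' part len] have "P \<rho> - sf_scale (N \<rho>) (gprod n (asc n \<rho>)) \<in> ?B"
      using symfun.span_mono by blast
    moreover have "gprod n (asc n \<rho>) \<in> ?B"
      using part len less' by (intro symfun.span_base) (auto simp: below_def)
    ultimately have "P \<rho> - sf_scale (N \<rho>) (gprod n (asc n \<rho>)) + sf_scale (N \<rho>) (gprod n (asc n \<rho>)) \<in> ?B"
      by (intro symfun.span_add symfun.span_scale)
    then show ?thesis by simp
  qed
  ultimately show ?case
    unfolding R_def by (auto intro!: symfun.span_neg symfun.span_scale symfun.span_sum)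
qed

lemma P_in_span_gprod:
  assumes "is_partition \<nu>" "length \<nu> \<le> n"
  shows "P \<nu> \<in> symfun.span (range (gprod n))"
proof -
  have "below n (pair_min (mset \<nu>)) \<subseteq> range (gprod n)" by (auto simp: below_def)
  then have "P \<nu> - sf_scale (N \<nu>) (gprod n (asc n \<nu>)) \<in> symfun.span (range (gprod n))"
    using P_gprod_triangular[OF assms] symfun.span_mono by blast
  then have "P \<nu> - sf_scale (N \<nu>) (gprod n (asc n \<nu>)) + sf_scale (N \<nu>) (gprod n (asc n \<nu>)) \<in> symfun.span (range (gprod n))"
    by (intro symfun.span_add symfun.span_scale) (auto intro: symfun.span_base)
  then show ?thesis by simp
qed

text \<open>A nontrivial permutation leads to a monomial with \<open>pair_min\<close> below that of
  \<open>\<nu>\<close>, which \<open>P \<nu>\<close> does not contain, so only the diagonal term is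
  left.\<close>

lemma jack_inner_jt_self:
  assumes "is_partition \<nu>" "length \<nu> \<le> n"
  shows "jack_inner (jt c n (asc n \<nu>)) (P \<nu>) = (\<Prod>i<n. of_nat (i + c) + kk * of_nat (asc n \<nu> i))"
proof -
  have "jack_inner (jt c n (asc n \<nu>)) (P \<nu>) = (\<Sum>w | w permutes {0..<n}.
     if w = id then \<Prod>i<n. of_nat (i + c) + kk * of_nat (asc n \<nu> i) else 0)"
    unfolding jack_inner_jt
  proof (rule sum.cong[OF refl])
    fix w assume "w \<in> {w. w permutes {0..<n}}"
    then have w: "w permutes {0..<n}" by simp
    let ?m = "monom_of n (\<lambda>i. asc n \<nu> i + i - w i)"
    have "sf_coeff (P \<nu>) ?m = 0" if "\<forall>i<n. w i \<le> asc n \<nu> i + i" "w \<noteq> id"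
      using monom_of_permute_less[OF assms w that(1)] that(2) P_coeff_nonzero[OF assms(1), of ?m] by auto
    moreover have "sf_coeff (P \<nu>) (monom_of n (asc n \<nu>)) = 1"
      using assms by (simp add: P_coeff_self exponents_asc)
    ultimately show "of_int (sign w) * (if \<forall>i<n. w i \<le> asc n \<nu> i + i
        then (\<Prod>i<n. of_nat (w i + c) + kk * of_nat (asc n \<nu> i + i - w i)) * sf_coeff (P \<nu>) ?m else 0) =
      (if w = id then \<Prod>i<n. of_nat (i + c) + kk * of_nat (asc n \<nu> i) else 0)"
      by (auto simp: sign_id)
  qed
  then show ?thesis by (simp add: finite_permutations permutes_id)
qed

text \<open>Some permutation must give a monomial that occurs in \<open>P \<rho>\<close>. It has at
  most \<open>n\<close> variables, and its \<open>pair_min\<close> lies between that of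
  \<open>\<rho>\<close> and that of \<open>\<nu>\<close>.\<close>

lemma jack_inner_jt_nonzero:
  assumes "is_partition \<nu>" "length \<nu> \<le> n" "is_partition \<rho>" "jack_inner (jt c n (asc n \<nu>)) (P \<rho>) \<noteq> 0"
  shows "length \<rho> \<le> n \<and> (\<rho> = \<nu> \<or> pair_min (mset \<rho>) < pair_min (mset \<nu>))"
proof -
  have "\<exists>w. w permutes {0..<n} \<and> (\<forall>i<n. w i \<le> asc n \<nu> i + i) \<and>
      sf_coeff (P \<rho>) (monom_of n (\<lambda>i. asc n \<nu> i + i - w i)) \<noteq> 0"
  proof (rule ccontr)
    assume "\<not> ?thesis"
    then have "jack_inner (jt c n (asc n \<nu>)) (P \<rho>) = 0"
      unfolding jack_inner_jt by (intro sum.neutral) auto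
    with assms(4) show False by simp
  qed
  then obtain w where w: "w permutes {0..<n}" "\<forall>i<n. w i \<le> asc n \<nu> i + i"
    and nz: "sf_coeff (P \<rho>) (monom_of n (\<lambda>i. asc n \<nu> i + i - w i)) \<noteq> 0" by blast
  have "length \<rho> \<le> n"
    using P_vanishing[OF assms(3), of n] nz card_set_monom_of by (force simp: vanishing_def)
  moreover have "\<rho> = \<nu> \<or> pair_min (mset \<rho>) < pair_min (mset \<nu>)"
    using P_coeff_nonzero[OF assms(3) nz] monom_of_permute_less[OF assms(1,2) w]
      is_partition_mset_eq[OF assms(1,3)] by auto
  ultimately show ?thesis by simp
qed

section \<open>Multiplication by \<open>elem_sf n\<close> and the quotient of norms\<close>

text \<open>\<open>P (up n \<nu>)\<close> is replaced by its expansion in products of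
  \<open>gs\<close>. The lower products pair to 0, since lowering their exponents by 1 leaves
  monomials absent from \<open>P \<nu>\<close>; the leading one pairs to 1.\<close>

lemma elem_sf_P_up:
  assumes "is_partition \<nu>" "length \<nu> \<le> n"
  shows "jack_inner (elem_sf n * P \<nu>) (P (up n \<nu>)) = N (up n \<nu>)"
proof -
  let ?e = "elem_sf n * P \<nu>" and ?\<mu> = "up n \<nu>"
  have \<mu>: "is_partition ?\<mu>" "length ?\<mu> \<le> n" using assms is_partition_up by auto
  have "jack_inner ?e h = 0" if "h \<in> symfun.span (below n (pair_min (mset ?\<mu>)))" for h
    using that
  proof (induction h rule: symfun.span_induct_alt)
    case (step c x y)
    then obtain \<sigma> where \<sigma>: "x = gprod n (asc n \<sigma>)" "is_partition \<sigma>" "length \<sigma> \<le> n"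
      "pair_min (mset \<sigma>) < pair_min (mset \<nu>) + n * n"
      using pair_min_up[OF assms] by (auto simp: below_def)
    have "jack_inner ?e x = (if \<forall>i<n. 0 < asc n \<sigma> i then sf_coeff (P \<nu>) (monom_of n (\<lambda>i. asc n \<sigma> i - 1)) else 0)"
      by (simp add: \<sigma>(1) jack_inner_commute[of ?e] jack_inner_gprod sf_coeff_elem_sf_mult)
    also have "\<dots> = 0"
    proof (cases "\<forall>i<n. 0 < asc n \<sigma> i")
      case True
      then have "pair_min (exponents (monom_of n (\<lambda>i. asc n \<sigma> i - 1))) < pair_min (mset \<nu>)"
        using pair_min_exponents_pred[OF True] \<sigma>(4) exponents_asc[OF \<sigma>(2,3)] by simp
      then show ?thesis using P_coeff_nonzero[OF assms(1), of "monom_of n (\<lambda>i. asc n \<sigma> i - 1)"] True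
        by (metis (mono_tags, lifting) less_asym less_irrefl)
    qed auto
    finally show ?case using step by simp
  qed simp
  from this[OF P_gprod_triangular[OF \<mu>]]
  have "jack_inner ?e (P ?\<mu>) = N ?\<mu> * jack_inner ?e (gprod n (asc n ?\<mu>))" by simp
  also have "jack_inner ?e (gprod n (asc n ?\<mu>)) = sf_coeff (P \<nu>) (monom_of n (\<lambda>i. asc n ?\<mu> i - 1))"
    by (simp add: jack_inner_commute[of ?e] jack_inner_gprod sf_coeff_elem_sf_mult asc_up)
  also have "monom_of n (\<lambda>i. asc n ?\<mu> i - 1) = monom_of n (asc n \<nu>)"
    by (rule monom_of_cong) (simp add: asc_up)
  also have "sf_coeff (P \<nu>) (monom_of n (asc n \<nu>)) = 1"
    using assms by (simp add: P_coeff_self exponents_asc)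
  finally show ?thesis by simp
qed

text \<open>Here A equal to \<open>elem_sf n\<close> times B in \<open>n\<close> variables is paired
  with \<open>P (up n \<mu>)\<close>. In the expansion of B the hypothesis \<open>zero\<close>
  removes all terms except \<open>\<rho> = \<nu>\<close>. Separate \<open>\<mu>\<close> and
  \<open>\<nu>\<close> serve both the vanishing and the final comparison.\<close>

lemma jt_expansion_pairing:
  assumes "0 < n" "is_partition \<nu>" "length \<nu> \<le> n" "is_partition \<mu>" "length \<mu> \<le> n"
    and zero: "\<And>\<rho>. is_partition \<rho> \<Longrightarrow> length \<rho> \<le> n \<Longrightarrow> pair_min (mset \<rho>) < pair_min (mset \<nu>) \<Longrightarrow>
      jack_inner (elem_sf n * P \<rho>) (P (up n \<mu>)) = 0"
  shows "(\<Prod>i<n. of_nat (i + 1) + kk * of_nat (asc n \<nu> i)) / N \<nu> * jack_inner (elem_sf n * P \<nu>) (P (up n \<mu>)) =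
    jack_inner (jt 0 n (asc n (up n \<nu>))) (P (up n \<mu>))"
proof -
  let ?f = "jt 1 n (asc n \<nu>)" and ?Q = "P (up n \<mu>)"
  define b where "b = (\<Prod>i<n. of_nat (i + 1) + kk * of_nat (asc n \<nu> i))"
  obtain T where T: "finite T" "\<And>\<rho>. \<rho> \<in> T \<longleftrightarrow> is_partition \<rho> \<and> jack_inner ?f (P \<rho>) \<noteq> 0"
    "?f = (\<Sum>\<rho>\<in>T. sf_scale (jack_inner ?f (P \<rho>) / N \<rho>) (P \<rho>))"
    using P_expansion[of ?f] by blast
  have b: "jack_inner ?f (P \<nu>) = b" unfolding b_def using assms(2,3) by (rule jack_inner_jt_self)
  have "vanishing n (jt 0 n (asc n (up n \<nu>)) - elem_sf n * ?f)"
    using jt_Suc_vanishing[OF assms(1), of "asc n \<nu>"] jt_cong[of n "asc n (up n \<nu>)" "\<lambda>i. asc n \<nu> i + 1" 0]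
    by (simp add: asc_up)
  then have "jack_inner (jt 0 n (asc n (up n \<nu>)) - elem_sf n * ?f) ?Q = 0"
    by (rule jack_inner_vanishing) (use assms(4) in \<open>simp add: P_in_span_gprod is_partition_up\<close>)
  then have "jack_inner (jt 0 n (asc n (up n \<nu>))) ?Q = jack_inner (elem_sf n * ?f) ?Q" by simp
  also have "\<dots> = (\<Sum>\<rho>\<in>T. jack_inner ?f (P \<rho>) / N \<rho> * jack_inner (elem_sf n * P \<rho>) ?Q)"
    by (subst T(3)) (simp add: sum_distrib_left sf_scale_mult)
  also have "\<dots> = (\<Sum>\<rho>\<in>T. if \<rho> = \<nu> then b / N \<nu> * jack_inner (elem_sf n * P \<nu>) ?Q else 0)"
  proof (rule sum.cong[OF refl])
    fix \<rho> assume "\<rho> \<in> T"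
    then have "is_partition \<rho>" "jack_inner ?f (P \<rho>) \<noteq> 0" using T(2) by auto
    then have "\<rho> \<noteq> \<nu> \<Longrightarrow> jack_inner (elem_sf n * P \<rho>) ?Q = 0"
      using jack_inner_jt_nonzero[OF assms(2,3)] by (intro zero) blast+
    then show "jack_inner ?f (P \<rho>) / N \<rho> * jack_inner (elem_sf n * P \<rho>) ?Q =
        (if \<rho> = \<nu> then b / N \<nu> * jack_inner (elem_sf n * P \<nu>) ?Q else 0)"
      unfolding b[symmetric] by simp
  qed
  also have "\<dots> = b / N \<nu> * jack_inner (elem_sf n * P \<nu>) ?Q"
    using T(1) T(2)[rule_format, of \<nu>] assms(2) unfolding b by auto
  finally show ?thesis by (simp add: b_def)
qed

text \<open>Once the lower terms vanish, the identity at \<open>\<mu> = \<nu>\<close> compares the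
  diagonal coefficients of A and B.\<close>

lemma N_up:
  assumes "0 < n" "is_partition \<nu>" "length \<nu> \<le> n"
  shows "N (up n \<nu>) * (\<Prod>i<n. of_nat (i + 1) + kk * of_nat (asc n \<nu> i)) =
    N \<nu> * (\<Prod>i<n. of_nat i + kk * of_nat (asc n \<nu> i + 1))"
proof -
  \<comment> \<open>Upper triangularity of multiplication by \<open>elem_sf n\<close>, by induction
    on \<open>pair_min\<close>: \<open>P (up n \<nu>)\<close> comes too late to occur in A for
    \<open>up n \<rho>\<close>, and the diagonal coefficient of B is nonzero.\<close>
  have zero: "jack_inner (elem_sf n * P \<rho>) (P (up n \<nu>)) = 0"
    if "is_partition \<rho>" "length \<rho> \<le> n" "pair_min (mset \<rho>) < pair_min (mset \<nu>)" for \<rho>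
    using that
  proof (induction "pair_min (mset \<rho>)" arbitrary: \<rho> rule: less_induct)
    case less
    have "jack_inner (jt 0 n (asc n (up n \<rho>))) (P (up n \<nu>)) = 0"
    proof (rule ccontr)
      assume "\<not> ?thesis"
      from jack_inner_jt_nonzero[OF _ _ _ this] less.prems assms
      have "up n \<nu> = up n \<rho> \<or> pair_min (mset (up n \<nu>)) < pair_min (mset (up n \<rho>))"
        by (simp add: is_partition_up)
      then have "pair_min (mset (up n \<nu>)) \<le> pair_min (mset (up n \<rho>))" by auto
      then show False using less.prems assms by (simp add: pair_min_up)
    qed
    moreover have "(\<Prod>i<n. of_nat (i + 1) + kk * of_nat (asc n \<rho> i)) \<noteq> 0"
      by (simp only: prod_zero_iff finite_lessThan kk_generic) auto
    ultimately show ?case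
      using jt_expansion_pairing[OF assms(1) less.prems(1,2) assms(2,3) less.hyps] less.prems(3) N_nonzero[OF less.prems(1)]
      by simp
  qed
  have "(\<Prod>i<n. of_nat (i + 1) + kk * of_nat (asc n \<nu> i)) / N \<nu> * N (up n \<nu>) =
     jack_inner (jt 0 n (asc n (up n \<nu>))) (P (up n \<nu>))"
    using jt_expansion_pairing[OF assms(1) assms(2,3) assms(2,3) zero] elem_sf_P_up[OF assms(2,3)] by simp
  also have "\<dots> = (\<Prod>i<n. of_nat i + kk * of_nat (asc n \<nu> i + 1))"
    using jack_inner_jt_self[OF is_partition_up[OF assms(2)], of n n 0] by (simp add: asc_up)
  finally show ?thesis using N_nonzero[OF assms(2)] by (simp add: field_simps)
qed

end

section \<open>Removing the first column of a partition\<close>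

lemma filter_nonzero_padded:
  "sorted_wrt (\<ge>) ys \<Longrightarrow>
    filter (\<lambda>x. x \<noteq> 0) ys @ replicate (length ys - length (filter (\<lambda>x. x \<noteq> 0) ys)) 0 = (ys :: nat list)"
proof (induction ys)
  case (Cons y ys)
  show ?case
  proof (cases "y = 0")
    case True
    with Cons.prems have "\<forall>x\<in>set ys. x = 0" by auto
    then have "filter (\<lambda>x. x \<noteq> 0) ys = []" "replicate (length ys) 0 = ys"
      by (auto simp: filter_empty_conv replicate_length_same)
    with True show ?thesis by simp
  next
    case False
    have "length (filter (\<lambda>x. x \<noteq> 0) ys) \<le> length ys" by simp
    with False Cons show ?thesis by simp
  qed
qed simp

definition down :: "nat list \<Rightarrow> nat list" where
  "down \<nu> = filter (\<lambda>x. x \<noteq> 0) (map (\<lambda>x. x - 1) \<nu>)"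

text \<open>In the lowered list the zeros stand at the end, so it is \<open>down \<nu>\<close>
  padded to length \<open>length \<nu>\<close>, exactly the padding that \<open>up\<close>
  refills.\<close>

lemma
  assumes "is_partition \<nu>"
  shows is_partition_down: "is_partition (down \<nu>)"
    and up_down: "up (length \<nu>) (down \<nu>) = \<nu>"
    and length_down: "length (down \<nu>) \<le> length \<nu>"
    and sum_list_down: "sum_list (down \<nu>) + length \<nu> = sum_list \<nu>"
proof -
  let ?m = "map (\<lambda>x. x - 1) \<nu>"
  have pos: "0 \<notin> set \<nu>" and sorted: "sorted_wrt (\<ge>) ?m"
    using assms by (auto simp: is_partition_def sorted_wrt_iff_nth_less intro!: diff_le_mono)
  show part: "is_partition (down \<nu>)"
    using sorted by (auto simp: is_partition_def down_def sorted_wrt_filter)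
  show len: "length (down \<nu>) \<le> length \<nu>"
    unfolding down_def by (rule order_trans[OF length_filter_le]) simp
  have "down \<nu> @ replicate (length \<nu> - length (down \<nu>)) 0 = ?m"
    using filter_nonzero_padded[OF sorted] by (simp add: down_def)
  then have m: "map (\<lambda>i. part (down \<nu>) (Suc i)) [0..<length \<nu>] = ?m"
    using map_part[OF len] by simp
  have "up (length \<nu>) (down \<nu>) = map Suc (map (\<lambda>i. part (down \<nu>) (Suc i)) [0..<length \<nu>])"
    by (simp add: up_def)
  also have "\<dots> = \<nu>" unfolding m map_map using pos by (intro map_idI) (auto, metis Suc_pred gr0I)
  finally show "up (length \<nu>) (down \<nu>) = \<nu>" .
  have "sum_list (filter (\<lambda>x. x \<noteq> 0) ys) = sum_list ys" for ys :: "nat list"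
    by (induction ys) auto
  then have "sum_list (down \<nu>) = sum_list ?m" by (simp add: down_def)
  also have "sum_list ?m + length \<nu> = sum_list \<nu>" using pos by (induction \<nu>) auto
  finally show "sum_list (down \<nu>) + length \<nu> = sum_list \<nu>" by simp
qed

section \<open>The product over the boxes\<close>

definition box_factor :: "nat list \<Rightarrow> nat \<times> nat \<Rightarrow> ratfun" where
  "box_factor \<nu> s = (of_nat (leg \<nu> s) + (of_nat (arm \<nu> s) + 1) * kk) /
     (of_nat (leg \<nu> s) + 1 + of_nat (arm \<nu> s) * kk)"

text \<open>The new column is numbered from the bottom, so that its box number \<open>i\<close> has
  leg \<open>i\<close> and arm \<open>asc n \<nu> i\<close>; the old boxes move one column to the
  right.\<close>

lemma boxes_up:
  assumes "length \<nu> \<le> n"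
  shows "boxes (up n \<nu>) = (\<lambda>i. (n - i, 1)) ` {..<n} \<union> map_prod id Suc ` boxes \<nu>"
proof (intro equalityI subsetI)
  fix s assume s: "s \<in> boxes (up n \<nu>)"
  obtain i j where ij: "s = (i, j)" by (cases s)
  with s have *: "1 \<le> i" "i \<le> n" "1 \<le> j" "j \<le> part \<nu> i + 1"
    by (auto simp: boxes_def part_up split: if_splits)
  show "s \<in> (\<lambda>i. (n - i, 1)) ` {..<n} \<union> map_prod id Suc ` boxes \<nu>"
  proof (cases "j = 1")
    case True
    with * ij show ?thesis by (intro UnI1 image_eqI[of _ _ "n - i"]) auto
  next
    case False
    with * ij show ?thesis by (intro UnI2 image_eqI[of _ _ "(i, j - 1)"]) (auto simp: boxes_def)
  qed
next
  fix s assume s: "s \<in> (\<lambda>i. (n - i, 1)) ` {..<n} \<union> map_prod id Suc ` boxes \<nu>"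
  have "i \<le> n" if "1 \<le> j" "j \<le> part \<nu> i" for i j
    using that assms by (auto simp: part_def split: if_splits)
  with s show "s \<in> boxes (up n \<nu>)" by (auto simp: boxes_def part_up)
qed

lemma conj_part_up:
  assumes "length \<nu> \<le> n"
  shows "conj_part (up n \<nu>) (Suc j) = (if j = 0 then n else conj_part \<nu> j)"
proof -
  have "{i. 1 \<le> i \<and> i \<le> length (up n \<nu>) \<and> Suc j \<le> part (up n \<nu>) i} = {i. 1 \<le> i \<and> i \<le> n \<and> j \<le> part \<nu> i}"
    by (auto simp: part_up)
  also have "\<dots> = (if j = 0 then {1..n} else {i. 1 \<le> i \<and> i \<le> length \<nu> \<and> j \<le> part \<nu> i})"
    using assms by (auto simp: part_def)
  finally show ?thesis by (simp add: conj_part_def)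
qed

text \<open>Moved boxes keep arm and leg, so the products differ only by the new column, whose
  factors are those in the quotient of norms.\<close>

lemma prod_box_factor_up:
  assumes "length \<nu> \<le> n"
  shows "prod (box_factor (up n \<nu>)) (boxes (up n \<nu>)) =
    (\<Prod>i<n. (of_nat i + kk * of_nat (asc n \<nu> i + 1)) / (of_nat (i + 1) + kk * of_nat (asc n \<nu> i))) *
    prod (box_factor \<nu>) (boxes \<nu>)"
proof -
  have inj: "inj_on (\<lambda>i. (n - i, 1::nat)) {..<n}" "inj_on (map_prod id Suc) (boxes \<nu>)"
    by (auto simp: inj_on_def)
  have "(\<lambda>i. (n - i, 1)) ` {..<n} \<inter> map_prod id Suc ` boxes \<nu> = {}"
    by (auto simp: boxes_def)
  then have "prod (box_factor (up n \<nu>)) (boxes (up n \<nu>)) =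
     (\<Prod>i<n. box_factor (up n \<nu>) (n - i, 1)) * (\<Prod>s\<in>boxes \<nu>. box_factor (up n \<nu>) (map_prod id Suc s))"
    unfolding boxes_up[OF assms]
    by (simp add: prod.union_disjoint finite_boxes prod.reindex inj del: One_nat_def)
  also have "(\<Prod>i<n. box_factor (up n \<nu>) (n - i, 1)) =
      (\<Prod>i<n. (of_nat i + kk * of_nat (asc n \<nu> i + 1)) / (of_nat (i + 1) + kk * of_nat (asc n \<nu> i)))"
    using conj_part_up[OF assms, of 0]
    by (intro prod.cong refl) (simp add: box_factor_def arm_def leg_def part_up asc_def Suc_le_eq algebra_simps)
  also have "(\<Prod>s\<in>boxes \<nu>. box_factor (up n \<nu>) (map_prod id Suc s)) = prod (box_factor \<nu>) (boxes \<nu>)"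
  proof (rule prod.cong[OF refl])
    fix s assume "s \<in> boxes \<nu>"
    then obtain i j where s: "s = (i, j)" "1 \<le> i" "1 \<le> j" "j \<le> part \<nu> i" by (auto simp: boxes_def)
    then have "i \<le> n" using assms by (auto simp: part_def split: if_splits)
    with s show "box_factor (up n \<nu>) (map_prod id Suc s) = box_factor \<nu> s"
      by (simp add: box_factor_def arm_def leg_def part_up conj_part_up[OF assms])
  qed
  finally show ?thesis .
qed

context jack
begin

lemma N_Nil: "N [] = 1"
proof -
  have "{\<mu>. is_partition \<mu> \<and> dominated \<mu> [] \<and> \<mu> \<noteq> []} = {}"
    by (auto simp: is_partition_def dominated_def neq_Nil_conv)
  moreover have "is_partition []" by (simp add: is_partition_def)
  ultimately have "P [] = monomial_sf []" using P_expand[of "[]"] by (metis (no_types, lifting) add.right_neutral sum.empty)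
  also have "\<dots> = pm {#}"
    by (rule sf_eqI) (auto simp: sf_coeff_monomial_sf exponents_def mset_set_empty_iff)
  finally show ?thesis by (simp add: jack_inner_pm[of "{#}" "{#}", simplified] wt_def zm_def)
qed

text \<open>With \<open>n\<close> the length of \<open>\<nu>\<close>, removing the first column
  lowers the weight by \<open>n\<close> and divides the norm and the box product by the same
  factor.\<close>

lemma N_eq_prod: "is_partition \<nu> \<Longrightarrow> N \<nu> = prod (box_factor \<nu>) (boxes \<nu>)"
proof (induction "sum_list \<nu>" arbitrary: \<nu> rule: less_induct)
  case less
  show ?case
  proof (cases "\<nu> = []")
    case True
    have "boxes [] = {}" by (auto simp: boxes_def part_def)
    with True show ?thesis by (simp add: N_Nil)
  next
    case False
    define n \<mu> where "n = length \<nu>" and "\<mu> = down \<nu>"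
    have n: "0 < n" using False by (simp add: n_def)
    have \<mu>: "is_partition \<mu>" "length \<mu> \<le> n" "\<nu> = up n \<mu>" "sum_list \<mu> + n = sum_list \<nu>"
      using is_partition_down[OF less.prems] length_down[OF less.prems] up_down[OF less.prems]
        sum_list_down[OF less.prems] by (simp_all add: n_def \<mu>_def)
    have IH: "N \<mu> = prod (box_factor \<mu>) (boxes \<mu>)"
      by (rule less.hyps) (use \<mu> n in auto)
    have nz: "(\<Prod>i<n. of_nat (i + 1) + kk * of_nat (asc n \<mu> i)) \<noteq> 0"
      by (simp only: prod_zero_iff finite_lessThan kk_generic) auto
    have "N \<nu> = (\<Prod>i<n. of_nat i + kk * of_nat (asc n \<mu> i + 1)) / (\<Prod>i<n. of_nat (i + 1) + kk * of_nat (asc n \<mu> i)) * N \<mu>"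
      unfolding \<mu>(3) using N_up[OF n \<mu>(1,2)] nz by (simp add: field_simps)
    also have "\<dots> = prod (box_factor \<nu>) (boxes \<nu>)"
      unfolding IH \<mu>(3) prod_box_factor_up[OF \<mu>(2)] prod_dividef ..
    finally show ?thesis .
  qed
qed

end

theorem proposition3p21:
  fixes P :: "nat list \<Rightarrow> ratfun symfun" and \<nu> :: "nat list"
  assumes "is_jack P"
    and "is_partition \<nu>"
  shows "jack_inner (P \<nu>) (P \<nu>) =
    (\<Prod>s\<in>boxes \<nu>.
       (of_nat (leg \<nu> s) + (of_nat (arm \<nu> s) + 1) * kk) /
       (of_nat (leg \<nu> s) + 1 + of_nat (arm \<nu> s) * kk))"
proof -
  interpret jack P by unfold_locales (rule assms(1))
  show ?thesis using N_eq_prod[OF assms(2)] by (simp add: box_factor_def)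
qed

end
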